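(* Let $n\ge 3$ be an integer and let $X_1,X_2,\ldots,X_n$ be independent, identically distributed positive random variables whose common distribution $F$ has a density $f$ that is positive and continuous on $(0,\infty)$. Let $X_{(1)}\le X_{(2)}\le\cdots\le X_{(n)}$ be the order statistics and $\overline{X}_n=\frac1n\sum_{i=1}^n X_i$ the sample mean. Let $p,a_1,a_2,\ldots,a_n$ be real numbers such that $p>0$, $a_1>0$, $a_n>0$, and $a_i\ge 0$ for $i=2,3,\ldots,n-1$. Define $$Z_n=\sum_{i=1}^n a_i\big|X_{(i)}-\overline{X}_n\big|^p.$$ Then $\overline{X}_n$ and $(Z_n)^{1/p}/\overline{X}_n$ are independent if and only if $F$ is a gamma distribution.
   Context: A distribution $F$ is a gamma distribution if, for some $a>0$ and $b>0$, it is absolutely continuous with density $\frac{1}{\Gamma(a)b^a}x^{a-1}e^{-x/b}$ for $x>0$ and $0$ for $x\le 0$. *)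

theory Defs
  imports "HOL-Probability.Probability"
begin

definition gamma_density :: "real \<Rightarrow> real \<Rightarrow> real \<Rightarrow> real" where
  "gamma_density a b x =
     (if x > 0 then 1 / (Gamma a * b powr a) * x powr (a - 1) * exp (- x / b) else 0)"

definition gamma_distribution :: "real measure \<Rightarrow> bool" where
  "gamma_distribution F \<longleftrightarrow>
     (\<exists>a>0. \<exists>b>0. F = density lborel (\<lambda>x. ennreal (gamma_density a b x)))"

text \<open>The sample is the family \<open>X 1, \<dots>, X n\<close>; the value \<open>X 0\<close> is never used.\<close>

definition sample_mean :: "nat \<Rightarrow> (nat \<Rightarrow> 'a \<Rightarrow> real) \<Rightarrow> 'a \<Rightarrow> real" where
  "sample_mean n X \<omega> = 1 / real n * (\<Sum>i=1..n. X i \<omega>)"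

text \<open>Ranks run from \<open>1\<close> (the minimum) to \<open>n\<close> (the maximum), whereas list positions start at \<open>0\<close>.\<close>

definition order_statistic :: "nat \<Rightarrow> (nat \<Rightarrow> 'a \<Rightarrow> real) \<Rightarrow> nat \<Rightarrow> 'a \<Rightarrow> real" where
  "order_statistic n X i \<omega> = sort (map (\<lambda>j. X j \<omega>) [1..<Suc n]) ! (i - 1)"

definition Z_stat ::
  "nat \<Rightarrow> (nat \<Rightarrow> real) \<Rightarrow> real \<Rightarrow> (nat \<Rightarrow> 'a \<Rightarrow> real) \<Rightarrow> 'a \<Rightarrow> real" where
  "Z_stat n a p X \<omega> =
     (\<Sum>i=1..n. a i * \<bar>order_statistic n X i \<omega> - sample_mean n X \<omega>\<bar> powr p)"

end

theory Submission
  imports Defs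
begin

text \<open>
  Write \<open>S\<close> for the sample mean and \<open>T\<close> for the ratio \<open>Z\<^sup>1\<^sup>/\<^sup>p / S\<close>. As a function of the sample,
  \<open>T\<close> is homogeneous of degree \<open>0\<close>, and since the extreme weights are positive it is comparable, on
  points of mean \<open>1\<close>, with the largest deviation of a coordinate from \<open>1\<close>. Writing a sample
  point in the positive orthant as \<open>s w\<close> with \<open>w\<close> in the simplex of mean \<open>1\<close>, Lebesgue measure
  becomes \<open>s\<^sup>n\<^sup>-\<^sup>1 ds\<close> times a measure \<open>dw\<close> on the simplex (\<open>nn_integral_polar\<close>), so that
  (\<open>joint_law\<close>) \<open>P (S \<in> A, T \<in> B)\<close> is the integral over \<open>s \<in> A\<close> of \<open>s\<^sup>n\<^sup>-\<^sup>1\<close> times the integral of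
  \<open>\<Prod>i. f (s w\<^sub>i)\<close> over those \<open>w\<close> with \<open>T w \<in> B\<close>.

  For a gamma density the identity \<open>\<Sum>i. w\<^sub>i = n\<close> turns \<open>\<Prod>i. f (s w\<^sub>i)\<close> into a function of \<open>s\<close> times
  a function of \<open>w\<close>, and independence is visible (\<open>independent_if_gamma\<close>).

  Conversely, independence says that the integral of \<open>\<Prod>i. f (s w\<^sub>i)\<close> over \<open>{T w \<le> t}\<close> has the form
  \<open>q t * R s\<close>; a priori for almost all \<open>s\<close>, by continuity for all. As \<open>t\<close> tends to \<open>0\<close> the region
  contracts to the point \<open>(1, \<dots>, 1)\<close>, which identifies \<open>R s\<close> with \<open>f s ^ n\<close> up to a constant: the
  integral equals \<open>c t * f s ^ n\<close>. If \<open>ln f\<close> were twice differentiable, expanding to second order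
  (the first order cancels because \<open>\<Sum>i. (w\<^sub>i - 1) = 0\<close>) would give that \<open>s\<^sup>2 (ln f)'' s\<close> is constant.
  Since \<open>f\<close> is only continuous, a maximum principle replaces the expansion. The function
  \<open>x powr A\<close> satisfies the same identity with a constant \<open>c\<^sub>A t\<close> that is strictly decreasing in \<open>A\<close>,
  by the inequality of arithmetic and geometric means. If \<open>ln f - A ln\<close> exceeds one of its chords at
  an inner point, then at some \<open>s\<close> it has a local affine majorant touching it there
  (\<open>affine_majorant_at_point\<close>); the affine part cancels in the sum over \<open>i\<close>, and hence
  \<open>c t \<le> c\<^sub>A t\<close> for all small \<open>t\<close>. If \<open>ln f - A ln\<close> falls below a chord, the reverse inequality
  holds. Every chord with a marked inner point has exactly one exponent \<open>A\<close> at which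
  \<open>ln f - A ln\<close> meets the chord there, and by the strict monotonicity of \<open>c\<^sub>A\<close> no two of these
  exponents can differ. So \<open>ln f - A ln\<close> is affine for one and the same \<open>A\<close>
  (\<open>power_exponential_of_factorization\<close>), and integrability of \<open>f\<close> restricts the parameters to those
  of a gamma density (\<open>gamma_distribution_of_power_exponential\<close>).
\<close>

section \<open>Order statistics\<close>

lemma sorted_nth_le_iff:
  fixes xs :: "'a::linorder list"
  assumes "sorted xs" "k < length xs"
  shows "xs ! k \<le> c \<longleftrightarrow> k < length (filter (\<lambda>x. x \<le> c) xs)"
  using assms
proof (induction xs arbitrary: k)
  case (Cons x xs)
  show ?case
  proof (cases "x \<le> c")
    case True
    then show ?thesis using Cons by (cases k) auto
  next
    case False
    then have "filter (\<lambda>x. x \<le> c) (x # xs) = []"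
      using Cons.prems by (auto simp: filter_empty_conv)
    moreover have "x \<le> (x # xs) ! k"
      using Cons.prems by (cases k) auto
    ultimately show ?thesis using False by auto
  qed
qed simp

lemma sort_map_mono:
  assumes "mono f"
  shows "sort (map f xs) = map f (sort xs)"
  using assms by (intro properties_for_sort) (auto simp: sorted_map monoD intro: sorted_wrt_mono_rel[of _ "(\<le>)"])

lemma order_statistic_cong:
  assumes "\<And>i. i \<in> {1..n} \<Longrightarrow> X i \<omega> = Y i \<omega>'"
  shows "order_statistic n X k \<omega> = order_statistic n Y k \<omega>'"
proof -
  have "map (\<lambda>j. X j \<omega>) [1..<Suc n] = map (\<lambda>j. Y j \<omega>') [1..<Suc n]"
    using assms by (intro map_cong) auto
  then show ?thesis unfolding order_statistic_def by (simp only:)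
qed

lemma order_statistic_scale:
  assumes "s \<ge> 0" "k \<in> {1..n}"
  shows "order_statistic n (\<lambda>i \<omega>. s * X i \<omega>) k \<omega> = s * order_statistic n X k \<omega>"
proof -
  have "sort (map (\<lambda>j. s * X j \<omega>) [1..<Suc n]) = map ((*) s) (sort (map (\<lambda>j. X j \<omega>) [1..<Suc n]))"
    using sort_map_mono[of "(*) s" "map (\<lambda>j. X j \<omega>) [1..<Suc n]"] assms
    by (simp add: mono_def mult_left_mono comp_def del: upt_Suc)
  moreover have "k - 1 < length (sort (map (\<lambda>j. X j \<omega>) [1..<Suc n]))"
    using assms by auto
  ultimately show ?thesis
    unfolding order_statistic_def by (simp del: upt_Suc)
qed

lemma order_statistic_mem:
  assumes "k \<in> {1..n}"
  shows "order_statistic n X k \<omega> \<in> (\<lambda>i. X i \<omega>) ` {1..n}"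
proof -
  have "order_statistic n X k \<omega> \<in> set (sort (map (\<lambda>j. X j \<omega>) [1..<Suc n]))"
    unfolding order_statistic_def using assms by (intro nth_mem) auto
  then show ?thesis by (auto simp del: upt_Suc)
qed

lemma order_statistic_extremes:
  assumes "i \<in> {1..n}"
  shows "order_statistic n X 1 \<omega> \<le> X i \<omega>" "X i \<omega> \<le> order_statistic n X n \<omega>"
proof -
  let ?s = "sort (map (\<lambda>j. X j \<omega>) [1..<Suc n])"
  have "X i \<omega> \<in> set ?s" using assms by (auto simp del: upt_Suc)
  then obtain k where k: "k < length ?s" "X i \<omega> = ?s ! k"
    by (metis in_set_conv_nth)
  have "length ?s = n" by simp
  then show "order_statistic n X 1 \<omega> \<le> X i \<omega>" "X i \<omega> \<le> order_statistic n X n \<omega>"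
    unfolding order_statistic_def k(2) using k(1)
    by (auto intro!: sorted_nth_mono simp del: upt_Suc)
qed

text \<open>The event that the value of rank \<open>k\<close> is at most \<open>c\<close> is the event that at least \<open>k\<close> sample
  values are, and the number of these values is a finite sum of indicators.\<close>

lemma order_statistic_measurable:
  assumes X: "\<And>i. i \<in> {1..n} \<Longrightarrow> X i \<in> borel_measurable M" and k: "k \<in> {1..n}"
  shows "order_statistic n X k \<in> borel_measurable M"
  unfolding borel_measurable_iff_le
proof
  fix c :: real
  have count: "length (filter (\<lambda>x. x \<le> c) (sort (map (\<lambda>j. X j \<omega>) [1..<Suc n])))
      = (\<Sum>i=1..n. if X i \<omega> \<le> c then 1 else 0)" for \<omega>
  proof -
    have "length (filter (\<lambda>x. x \<le> c) (sort (map (\<lambda>j. X j \<omega>) [1..<Suc n])))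
        = length (filter (\<lambda>x. x \<le> c) (map (\<lambda>j. X j \<omega>) [1..<Suc n]))"
      by (metis mset_filter mset_sort size_mset)
    also have "\<dots> = card ({i. X i \<omega> \<le> c} \<inter> {1..n})"
      by (simp add: filter_map comp_def distinct_length_filter atLeastLessThanSuc_atLeastAtMost
          del: upt_Suc)
    also have "\<dots> = (\<Sum>i=1..n. if X i \<omega> \<le> c then 1 else 0)"
      by (simp add: sum.If_cases Int_commute)
    finally show ?thesis .
  qed
  have "order_statistic n X k \<omega> \<le> c
      \<longleftrightarrow> k - 1 < (\<Sum>i=1..n. if X i \<omega> \<le> c then 1 else (0::nat))" for \<omega>
    unfolding order_statistic_def count[symmetric] using k
    by (intro sorted_nth_le_iff) auto
  then have "{\<omega> \<in> space M. order_statistic n X k \<omega> \<le> c}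
      = {\<omega> \<in> space M. k - 1 < (\<Sum>i=1..n. if X i \<omega> \<le> c then 1 else (0::nat))}" by simp
  also have "\<dots> \<in> sets M"
  proof -
    have [measurable]: "(\<lambda>\<omega>. \<Sum>i=1..n. if X i \<omega> \<le> c then 1 else (0::nat)) \<in> measurable M (count_space UNIV)"
      using X by (intro measurable_sum_nat) measurable
    show ?thesis by measurable
  qed
  finally show "{\<omega> \<in> space M. order_statistic n X k \<omega> \<le> c} \<in> sets M" .
qed

section \<open>The ratio of dispersion to mean\<close>

definition dispersion_ratio ::
  "nat \<Rightarrow> (nat \<Rightarrow> real) \<Rightarrow> real \<Rightarrow> (nat \<Rightarrow> 'a \<Rightarrow> real) \<Rightarrow> 'a \<Rightarrow> real" where
  "dispersion_ratio n a p X \<omega> = Z_stat n a p X \<omega> powr (1 / p) / sample_mean n X \<omega>"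

lemma sample_mean_cong:
  assumes "\<And>i. i \<in> {1..n} \<Longrightarrow> X i \<omega> = Y i \<omega>'"
  shows "sample_mean n X \<omega> = sample_mean n Y \<omega>'"
  unfolding sample_mean_def using assms by simp

lemma dispersion_ratio_cong:
  assumes "\<And>i. i \<in> {1..n} \<Longrightarrow> X i \<omega> = Y i \<omega>'"
  shows "dispersion_ratio n a p X \<omega> = dispersion_ratio n a p Y \<omega>'"
  using sample_mean_cong[of n X \<omega> Y \<omega>'] order_statistic_cong[of n X \<omega> Y \<omega>'] assms
  unfolding dispersion_ratio_def Z_stat_def by simp

lemma sample_mean_measurable:
  assumes "\<And>i. i \<in> {1..n} \<Longrightarrow> X i \<in> borel_measurable M"
  shows "sample_mean n X \<in> borel_measurable M"
proof -
  have "(\<lambda>\<omega>. 1 / real n * (\<Sum>i=1..n. X i \<omega>)) \<in> borel_measurable M"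
    using assms by measurable
  then show ?thesis unfolding sample_mean_def[abs_def] .
qed

lemma dispersion_ratio_measurable:
  assumes "\<And>i. i \<in> {1..n} \<Longrightarrow> X i \<in> borel_measurable M"
  shows "dispersion_ratio n a p X \<in> borel_measurable M"
proof -
  note [measurable] = sample_mean_measurable[OF assms] order_statistic_measurable[OF assms]
  have "(\<lambda>\<omega>. (\<Sum>i=1..n. a i * \<bar>order_statistic n X i \<omega> - sample_mean n X \<omega>\<bar> powr p) powr (1 / p)
      / sample_mean n X \<omega>) \<in> borel_measurable M"
    by measurable
  then show ?thesis unfolding dispersion_ratio_def[abs_def] Z_stat_def[abs_def] .
qed

lemma dispersion_ratio_scale:
  assumes "s > 0" "p > 0" and a: "\<And>i. i \<in> {1..n} \<Longrightarrow> a i \<ge> 0"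
  shows "dispersion_ratio n a p (\<lambda>i \<omega>. s * X i \<omega>) \<omega> = dispersion_ratio n a p X \<omega>"
proof -
  have m: "sample_mean n (\<lambda>i \<omega>. s * X i \<omega>) \<omega> = s * sample_mean n X \<omega>"
    unfolding sample_mean_def by (simp add: sum_distrib_left)
  have "Z_stat n a p (\<lambda>i \<omega>. s * X i \<omega>) \<omega> = s powr p * Z_stat n a p X \<omega>"
    unfolding Z_stat_def m sum_distrib_left
  proof (rule sum.cong[OF refl])
    fix i assume i: "i \<in> {1..n}"
    have "order_statistic n (\<lambda>i \<omega>. s * X i \<omega>) i \<omega> - s * sample_mean n X \<omega>
        = s * (order_statistic n X i \<omega> - sample_mean n X \<omega>)"
      using order_statistic_scale[OF _ i, of s X \<omega>] \<open>s > 0\<close> by (simp add: right_diff_distrib)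
    then show "a i * \<bar>order_statistic n (\<lambda>i \<omega>. s * X i \<omega>) i \<omega> - s * sample_mean n X \<omega>\<bar> powr p
        = s powr p * (a i * \<bar>order_statistic n X i \<omega> - sample_mean n X \<omega>\<bar> powr p)"
      using assms by (simp add: abs_mult powr_mult)
  qed
  moreover have "Z_stat n a p X \<omega> \<ge> 0"
    unfolding Z_stat_def using a by (intro sum_nonneg) auto
  ultimately show ?thesis
    unfolding dispersion_ratio_def m using assms
    by (simp add: powr_mult powr_powr)
qed

text \<open>The next two bounds make the sublevel sets of the ratio, among points of mean \<open>1\<close>, a
  neighbourhood base of the diagonal point. The upper bound replaces every deviation in the
  dispersion by the largest one.\<close>

lemma dispersion_ratio_upper:
  assumes "p > 0" and a: "\<And>i. i \<in> {1..n} \<Longrightarrow> a i \<ge> 0"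
    and mean: "sample_mean n X \<omega> = 1"
    and close: "\<And>i. i \<in> {1..n} \<Longrightarrow> \<bar>X i \<omega> - 1\<bar> \<le> \<delta>" and "\<delta> \<ge> 0"
  shows "dispersion_ratio n a p X \<omega> \<le> (\<Sum>i=1..n. a i) powr (1 / p) * \<delta>"
proof -
  have "Z_stat n a p X \<omega> \<le> (\<Sum>i=1..n. a i * \<delta> powr p)"
    unfolding Z_stat_def mean
  proof (rule sum_mono)
    fix i assume i: "i \<in> {1..n}"
    have "\<bar>order_statistic n X i \<omega> - 1\<bar> \<le> \<delta>"
      using order_statistic_mem[OF i, of X \<omega>] close by auto
    then show "a i * \<bar>order_statistic n X i \<omega> - 1\<bar> powr p \<le> a i * \<delta> powr p"
      using a[OF i] \<open>p > 0\<close> by (intro mult_left_mono powr_mono2) auto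
  qed
  moreover have "Z_stat n a p X \<omega> \<ge> 0"
    unfolding Z_stat_def using a by (intro sum_nonneg) auto
  ultimately have "Z_stat n a p X \<omega> powr (1 / p) \<le> ((\<Sum>i=1..n. a i) * \<delta> powr p) powr (1 / p)"
    using \<open>p > 0\<close> by (intro powr_mono2) (auto simp: sum_distrib_right)
  also have "\<dots> = (\<Sum>i=1..n. a i) powr (1 / p) * \<delta>"
    using assms by (simp add: powr_mult powr_powr sum_nonneg)
  finally show ?thesis unfolding dispersion_ratio_def mean by simp
qed

text \<open>Each observation lies between the minimum and the maximum, so one of these two deviates from
  the mean at least as much; the corresponding term of the dispersion has positive weight, and the
  other terms are nonnegative.\<close>

lemma dispersion_ratio_lower:
  assumes "p > 0" and a: "\<And>i. i \<in> {1..n} \<Longrightarrow> a i \<ge> 0" and "a 1 > 0" "a n > 0"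
    and mean: "sample_mean n X \<omega> = 1" and i: "i \<in> {1..n}"
  shows "(min (a 1) (a n)) powr (1 / p) * \<bar>X i \<omega> - 1\<bar> \<le> dispersion_ratio n a p X \<omega>"
proof -
  have "\<exists>k\<in>{1, n}. \<bar>X i \<omega> - 1\<bar> \<le> \<bar>order_statistic n X k \<omega> - 1\<bar>"
    using order_statistic_extremes[OF i, of X \<omega>] by (cases "X i \<omega> \<ge> 1") auto
  then obtain k where k: "k \<in> {1, n}" "\<bar>X i \<omega> - 1\<bar> \<le> \<bar>order_statistic n X k \<omega> - 1\<bar>" by blast
  then have kn: "k \<in> {1..n}" using i by auto
  have "min (a 1) (a n) * \<bar>X i \<omega> - 1\<bar> powr p \<le> a k * \<bar>order_statistic n X k \<omega> - 1\<bar> powr p"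
    using k assms by (intro mult_mono powr_mono2) auto
  also have "\<dots> \<le> Z_stat n a p X \<omega>"
    unfolding Z_stat_def mean
    by (rule member_le_sum[OF kn, where f="\<lambda>i. a i * \<bar>order_statistic n X i \<omega> - 1\<bar> powr p"])
       (use a in auto)
  finally have "(min (a 1) (a n) * \<bar>X i \<omega> - 1\<bar> powr p) powr (1 / p) \<le> Z_stat n a p X \<omega> powr (1 / p)"
    using assms by (intro powr_mono2) auto
  moreover have "(min (a 1) (a n) * \<bar>X i \<omega> - 1\<bar> powr p) powr (1 / p)
      = min (a 1) (a n) powr (1 / p) * \<bar>X i \<omega> - 1\<bar>"
    using assms by (simp add: powr_mult powr_powr)
  ultimately show ?thesis unfolding dispersion_ratio_def mean by simp
qed

section \<open>Polar coordinates on the positive orthant\<close>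

interpretation lborels: product_sigma_finite "\<lambda>_::nat. lborel::real measure"
  by standard

lemma nn_integral_PiM_scale:
  fixes G :: "(nat \<Rightarrow> real) \<Rightarrow> ennreal"
  assumes "finite I" "G \<in> borel_measurable (PiM I (\<lambda>_. lborel))" "r > 0"
  shows "(\<integral>\<^sup>+z. G z \<partial>PiM I (\<lambda>_. lborel))
      = ennreal (r ^ card I) * (\<integral>\<^sup>+z. G (\<lambda>i\<in>I. r * z i) \<partial>PiM I (\<lambda>_. lborel))"
  using assms(1,2)
proof (induction I arbitrary: G rule: finite_induct)
  case empty
  then show ?case by (simp add: lborels.nn_integral_empty restrict_def del: nn_integral_const)
next
  case (insert i I)
  note [measurable] = insert.prems
  have merge: "(\<lambda>j\<in>insert i I. r * (z(i := y)) j) = (\<lambda>j\<in>I. r * z j)(i := r * y)"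
    for z :: "nat \<Rightarrow> real" and y using insert.hyps by (auto simp: fun_eq_iff restrict_def)
  have "(\<integral>\<^sup>+z. G z \<partial>PiM (insert i I) (\<lambda>_. lborel))
      = (\<integral>\<^sup>+y. (\<integral>\<^sup>+z. G (z(i := y)) \<partial>PiM I (\<lambda>_. lborel)) \<partial>lborel)"
    using insert by (intro lborels.product_nn_integral_insert_rev) auto
  also have "\<dots> = ennreal r * (\<integral>\<^sup>+y. (\<integral>\<^sup>+z. G (z(i := r * y)) \<partial>PiM I (\<lambda>_. lborel)) \<partial>lborel)"
  proof (subst nn_integral_real_affine[where c=r and t=0])
    interpret sigma_finite_measure "PiM I (\<lambda>_. lborel :: real measure)"
      using lborels.sigma_finite insert by auto
    show "(\<lambda>y. \<integral>\<^sup>+z. G (z(i := y)) \<partial>PiM I (\<lambda>_. lborel)) \<in> borel_measurable borel"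
      by measurable
  qed (use \<open>r > 0\<close> in auto)
  also have "\<dots> = ennreal r * (\<integral>\<^sup>+y. ennreal (r ^ card I) *
      (\<integral>\<^sup>+z. G ((\<lambda>j\<in>I. r * z j)(i := r * y)) \<partial>PiM I (\<lambda>_. lborel)) \<partial>lborel)"
  proof -
    have "(\<integral>\<^sup>+z. G (z(i := r * y)) \<partial>PiM I (\<lambda>_. lborel)) = ennreal (r ^ card I) *
      (\<integral>\<^sup>+z. G ((\<lambda>j\<in>I. r * z j)(i := r * y)) \<partial>PiM I (\<lambda>_. lborel))" for y
      by (rule insert.IH) measurable
    then show ?thesis by simp
  qed
  also have "\<dots> = ennreal (r ^ card (insert i I)) *
      (\<integral>\<^sup>+y. (\<integral>\<^sup>+z. G ((\<lambda>j\<in>I. r * z j)(i := r * y)) \<partial>PiM I (\<lambda>_. lborel)) \<partial>lborel)"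
  proof -
    interpret sigma_finite_measure "PiM I (\<lambda>_. lborel :: real measure)"
      using lborels.sigma_finite insert by auto
    have "(\<lambda>y. \<integral>\<^sup>+z. G ((\<lambda>j\<in>I. r * z j)(i := r * y)) \<partial>PiM I (\<lambda>_. lborel)) \<in> borel_measurable lborel"
      by measurable
    then show ?thesis using insert.hyps \<open>r > 0\<close>
      by (simp add: nn_integral_cmult ennreal_mult mult.assoc)
  qed
  also have "(\<integral>\<^sup>+y. (\<integral>\<^sup>+z. G ((\<lambda>j\<in>I. r * z j)(i := r * y)) \<partial>PiM I (\<lambda>_. lborel)) \<partial>lborel)
      = (\<integral>\<^sup>+z. G (\<lambda>j\<in>insert i I. r * z j) \<partial>PiM (insert i I) (\<lambda>_. lborel))"
    using insert.hyps by (subst lborels.product_nn_integral_insert_rev) (auto simp: merge[symmetric])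
  finally show ?case .
qed

text \<open>Every ray of the positive orthant meets the hyperplane where the last coordinate is \<open>1\<close> exactly
  once, so rays are parametrized by the remaining coordinates \<open>z\<close>. The point \<open>ray_point n z\<close> is where
  the ray of \<open>z\<close> has coordinate mean \<open>1\<close>. This chart needs only one-dimensional substitutions.\<close>

definition ray_mean :: "nat \<Rightarrow> (nat \<Rightarrow> real) \<Rightarrow> real" where
  "ray_mean n z = (1 + (\<Sum>i\<in>{1..<n}. z i)) / real n"

definition ray_point :: "nat \<Rightarrow> (nat \<Rightarrow> real) \<Rightarrow> nat \<Rightarrow> real" where
  "ray_point n z = (\<lambda>i\<in>{1..n}. (z(n := 1)) i / ray_mean n z)"

text \<open>The measure on the set of rays that goes with the radial density \<open>s ^ (n - 1)\<close>. The absolute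
  value keeps the density nonnegative before the restriction to positive \<open>z\<close>.\<close>

definition ray_measure :: "nat \<Rightarrow> (nat \<Rightarrow> real) measure" where
  "ray_measure n = restrict_space
     (density (PiM {1..<n} (\<lambda>_. lborel)) (\<lambda>z. ennreal (1 / \<bar>ray_mean n z\<bar> ^ n)))
     {z. \<forall>i\<in>{1..<n}. z i > 0}"

lemma insert_last: "n \<ge> 1 \<Longrightarrow> {1..n} = insert n {1..<n::nat}" by auto

lemma ray_mean_pos: "n \<ge> 1 \<Longrightarrow> (\<And>i. i \<in> {1..<n} \<Longrightarrow> z i > 0) \<Longrightarrow> ray_mean n z > 0"
  unfolding ray_mean_def by (intro divide_pos_pos add_pos_nonneg sum_nonneg) (auto intro: less_imp_le)

lemma ray_mean_measurable [measurable]: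
  "ray_mean n \<in> borel_measurable (PiM {1..<n} (\<lambda>_. lborel))"
  unfolding ray_mean_def[abs_def] by measurable

text \<open>Integration over the orthant in the coordinates mean \<open>s\<close> and ray \<open>z\<close>. With the last coordinate
  \<open>r\<close> fixed, scaling the others by \<open>r\<close> contributes \<open>r ^ (n - 1)\<close>; with the ray fixed, the substitution
  \<open>s = r * ray_mean n z\<close> contributes the density of \<open>ray_measure n\<close>.\<close>

theorem nn_integral_polar:
  fixes K :: "(nat \<Rightarrow> real) \<Rightarrow> ennreal"
  assumes n: "n \<ge> 1" and K[measurable]: "K \<in> borel_measurable (PiM {1..n} (\<lambda>_. lborel))"
  shows "(\<integral>\<^sup>+x. K x * indicator {x. \<forall>i\<in>{1..n}. x i > 0} x \<partial>PiM {1..n} (\<lambda>_. lborel))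
    = (\<integral>\<^sup>+s. ennreal (s ^ (n - 1)) * indicator {0<..} s *
        (\<integral>\<^sup>+z. K (\<lambda>i\<in>{1..n}. s * ray_point n z i) \<partial>ray_measure n) \<partial>lborel)"
proof -
  let ?L = "PiM {1..<n} (\<lambda>_. lborel :: real measure)"
  let ?P = "{z::nat \<Rightarrow> real. \<forall>i\<in>{1..<n}. z i > 0}"
  let ?R = "\<lambda>r z. \<lambda>i\<in>{1..n}. r * (z(n := 1)) i"
  interpret L: sigma_finite_measure ?L using lborels.sigma_finite by auto
  interpret LP: pair_sigma_finite ?L lborel ..
  have updm: "(\<lambda>(z, r). z(n := r)) \<in> measurable (?L \<Otimes>\<^sub>M lborel) (PiM {1..n} (\<lambda>_. lborel))"
    using measurable_add_dim[of n "{1..<n}" "\<lambda>_. lborel"] n by (simp only: insert_last[OF n])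
  have Rm: "(\<lambda>(r, z). ?R r z) \<in> measurable (lborel \<Otimes>\<^sub>M ?L) (PiM {1..n} (\<lambda>_. lborel))"
  proof -
    have "(\<lambda>(r, z). r * (z(n := 1)) i) \<in> borel_measurable (lborel \<Otimes>\<^sub>M ?L)"
      if "i \<in> {1..n}" for i
    proof (cases "i = n")
      case False
      with that have i: "i \<in> {1..<n}" by auto
      then show ?thesis using False by simp
    qed simp
    then show ?thesis by (simp add: split_beta' measurable_restrict)
  qed
  have [measurable]: "(\<lambda>(r, z). K (?R r z)) \<in> borel_measurable (lborel \<Otimes>\<^sub>M ?L)"
    using measurable_compose[OF Rm K] by (simp add: split_beta')
  have upd[measurable]: "(\<lambda>z. K (z(n := r))) \<in> borel_measurable ?L" for r
    using measurable_compose[OF measurable_compose[OF _ updm] K, of "\<lambda>z. (z, r)" ?L] by simp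
  have ray: "(\<lambda>i\<in>{1..n}. s * ray_point n z i) = ?R (s / ray_mean n z) z" for s z
    by (auto simp: ray_point_def restrict_def)
  have "(\<integral>\<^sup>+x. K x * indicator {x. \<forall>i\<in>{1..n}. x i > 0} x \<partial>PiM {1..n} (\<lambda>_. lborel))
      = (\<integral>\<^sup>+r. (\<integral>\<^sup>+z. K (z(n := r)) * indicator {x. \<forall>i\<in>{1..n}. x i > 0} (z(n := r)) \<partial>?L) \<partial>lborel)"
  proof -
    define G where "G x = K x * indicator {x. \<forall>i\<in>{1..n}. x i > 0} x" for x
    have "G \<in> borel_measurable (PiM {1..n} (\<lambda>_. lborel))"
      unfolding G_def by measurable
    then have "integral\<^sup>N (PiM {1..n} (\<lambda>_. lborel)) G
        = (\<integral>\<^sup>+r. (\<integral>\<^sup>+z. G (z(n := r)) \<partial>?L) \<partial>lborel)"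
      unfolding insert_last[OF n] by (intro lborels.product_nn_integral_insert_rev) auto
    then show ?thesis unfolding G_def .
  qed
  also have "\<dots> = (\<integral>\<^sup>+r. indicator {0<..} r * (\<integral>\<^sup>+z. K (z(n := r)) * indicator ?P z \<partial>?L) \<partial>lborel)"
  proof (rule nn_integral_cong)
    fix r :: real
    have "indicator {x. \<forall>i\<in>{1..n}. x i > 0} (z(n := r)) = (indicator {0<..} r * indicator ?P z :: ennreal)" for z
      using n by (auto simp: indicator_def insert_last split: if_splits)
    then show "(\<integral>\<^sup>+z. K (z(n := r)) * indicator {x. \<forall>i\<in>{1..n}. x i > 0} (z(n := r)) \<partial>?L)
        = indicator {0<..} r * (\<integral>\<^sup>+z. K (z(n := r)) * indicator ?P z \<partial>?L)"
      by (cases "r > 0") simp_all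
  qed
  also have "\<dots> = (\<integral>\<^sup>+r. (\<integral>\<^sup>+z. indicator {0<..} r * (ennreal (r ^ (n - 1)) * (K (?R r z) * indicator ?P z)) \<partial>?L) \<partial>lborel)"
  proof (rule nn_integral_cong)
    fix r :: real
    show "indicator {0<..} r * (\<integral>\<^sup>+z. K (z(n := r)) * indicator ?P z \<partial>?L)
        = (\<integral>\<^sup>+z. indicator {0<..} r * (ennreal (r ^ (n - 1)) * (K (?R r z) * indicator ?P z)) \<partial>?L)"
    proof (cases "r > 0")
      case True
      have "(\<integral>\<^sup>+z. K (z(n := r)) * indicator ?P z \<partial>?L) = ennreal (r ^ card {1..<n}) *
          (\<integral>\<^sup>+z. K ((\<lambda>i\<in>{1..<n}. r * z i)(n := r)) * indicator ?P (\<lambda>i\<in>{1..<n}. r * z i) \<partial>?L)"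
        by (intro nn_integral_PiM_scale True finite_atLeastLessThan) measurable
      also have "\<dots> = ennreal (r ^ (n - 1)) * (\<integral>\<^sup>+z. K (?R r z) * indicator ?P z \<partial>?L)"
      proof -
        have "(\<lambda>i\<in>{1..<n}. r * z i)(n := r) = ?R r z" for z :: "nat \<Rightarrow> real"
          using n by (auto simp: fun_eq_iff restrict_def)
        moreover have "indicator ?P (\<lambda>i\<in>{1..<n}. r * z i) = (indicator ?P z :: ennreal)" for z
          using True by (auto simp: indicator_def zero_less_mult_iff)
        ultimately show ?thesis by simp
      qed
      also have "\<dots> = (\<integral>\<^sup>+z. ennreal (r ^ (n - 1)) * (K (?R r z) * indicator ?P z) \<partial>?L)"
        by (rule nn_integral_cmult[symmetric]) measurable
      finally show ?thesis using True by simp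
    qed simp
  qed
  also have "\<dots> = (\<integral>\<^sup>+z. (\<integral>\<^sup>+r. indicator {0<..} r * (ennreal (r ^ (n - 1)) * (K (?R r z) * indicator ?P z)) \<partial>lborel) \<partial>?L)"
    by (intro LP.Fubini') measurable
  also have "\<dots> = (\<integral>\<^sup>+z. (\<integral>\<^sup>+s. ennreal (s ^ (n - 1)) * indicator {0<..} s *
      (ennreal (1 / \<bar>ray_mean n z\<bar> ^ n) * (K (?R (s / ray_mean n z) z) * indicator ?P z)) \<partial>lborel) \<partial>?L)"
  proof (rule nn_integral_cong)
    fix z assume z: "z \<in> space ?L"
    show "(\<integral>\<^sup>+r. indicator {0<..} r * (ennreal (r ^ (n - 1)) * (K (?R r z) * indicator ?P z)) \<partial>lborel)
      = (\<integral>\<^sup>+s. ennreal (s ^ (n - 1)) * indicator {0<..} s *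
      (ennreal (1 / \<bar>ray_mean n z\<bar> ^ n) * (K (?R (s / ray_mean n z) z) * indicator ?P z)) \<partial>lborel)"
    proof (cases "z \<in> ?P")
      case True
      define m where "m = ray_mean n z"
      have m: "m > 0" using ray_mean_pos[OF n] True unfolding m_def by auto
      have mz: "(\<lambda>r. K (?R r z)) \<in> borel_measurable lborel"
        using measurable_Pair1[OF \<open>(\<lambda>(r, z). K (?R r z)) \<in> _\<close>] z by simp
      have "(\<integral>\<^sup>+r. indicator {0<..} r * (ennreal (r ^ (n - 1)) * (K (?R r z) * indicator ?P z)) \<partial>lborel)
        = \<bar>1 / m\<bar> * (\<integral>\<^sup>+s. indicator {0<..} (0 + 1 / m * s) * (ennreal ((0 + 1 / m * s) ^ (n - 1)) *
            (K (?R (0 + 1 / m * s) z) * indicator ?P z)) \<partial>lborel)"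
        using mz m by (intro nn_integral_real_affine) auto
      also have "\<dots> = (\<integral>\<^sup>+s. ennreal (1 / m) * (indicator {0<..} (0 + 1 / m * s) * (ennreal ((0 + 1 / m * s) ^ (n - 1)) *
            (K (?R (0 + 1 / m * s) z) * indicator ?P z))) \<partial>lborel)"
        using measurable_compose[OF _ mz, of "\<lambda>s. 0 + 1 / m * s"] m by (subst nn_integral_cmult) auto
      also have "\<dots> = (\<integral>\<^sup>+s. ennreal (s ^ (n - 1)) * indicator {0<..} s *
        (ennreal (1 / \<bar>m\<bar> ^ n) * (K (?R (s / m) z) * indicator ?P z)) \<partial>lborel)"
      proof (rule nn_integral_cong)
        fix s :: real
        show "ennreal (1 / m) * (indicator {0<..} (0 + 1 / m * s) * (ennreal ((0 + 1 / m * s) ^ (n - 1)) *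
            (K (?R (0 + 1 / m * s) z) * indicator ?P z)))
          = ennreal (s ^ (n - 1)) * indicator {0<..} s *
        (ennreal (1 / \<bar>m\<bar> ^ n) * (K (?R (s / m) z) * indicator ?P z))"
        proof (cases "s > 0")
          case s: True
          have "1 / m * (s / m) ^ (n - 1) = s ^ (n - 1) * (1 / \<bar>m\<bar> ^ n)"
            using m n by (cases n) (auto simp: field_simps)
          then have "ennreal (1 / m) * ennreal ((s / m) ^ (n - 1)) = ennreal (s ^ (n - 1)) * ennreal (1 / \<bar>m\<bar> ^ n)"
            using m s by (simp add: ennreal_mult[symmetric])
          then show ?thesis using s m by (simp add: mult.assoc[symmetric])
        next
          case False
          then have "\<not> 0 < 0 + 1 / m * s" using m by (simp add: zero_less_divide_iff)
          then show ?thesis using False by simp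
        qed
      qed
      finally show ?thesis unfolding m_def .
    qed simp
  qed
  also have "\<dots> = (\<integral>\<^sup>+s. (\<integral>\<^sup>+z. ennreal (s ^ (n - 1)) * indicator {0<..} s *
      (ennreal (1 / \<bar>ray_mean n z\<bar> ^ n) * (K (?R (s / ray_mean n z) z) * indicator ?P z)) \<partial>?L) \<partial>lborel)"
  proof (rule LP.Fubini'[symmetric])
    have "(\<lambda>(z, s). K (?R (s / ray_mean n z) z)) \<in> borel_measurable (?L \<Otimes>\<^sub>M lborel)"
    proof -
      have "(\<lambda>p. (snd p / ray_mean n (fst p), fst p)) \<in> measurable (?L \<Otimes>\<^sub>M lborel) (lborel \<Otimes>\<^sub>M ?L)"
        by measurable
      from measurable_compose[OF this measurable_compose[OF Rm K]] show ?thesis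
        by (simp only: split_beta' fst_conv snd_conv)
    qed
    then show "(\<lambda>(z, s). ennreal (s ^ (n - 1)) * indicator {0<..} s *
      (ennreal (1 / \<bar>ray_mean n z\<bar> ^ n) * (K (?R (s / ray_mean n z) z) * indicator ?P z)))
      \<in> borel_measurable (?L \<Otimes>\<^sub>M lborel)" 
      unfolding split_beta' by measurable
  qed
  also have "\<dots> = (\<integral>\<^sup>+s. ennreal (s ^ (n - 1)) * indicator {0<..} s *
        (\<integral>\<^sup>+z. K (\<lambda>i\<in>{1..n}. s * ray_point n z i) \<partial>ray_measure n) \<partial>lborel)"
  proof (rule nn_integral_cong)
    fix s :: real
    have [measurable]: "(\<lambda>z. K (?R (s / ray_mean n z) z)) \<in> borel_measurable ?L"
    proof -
      have "(\<lambda>z. (s / ray_mean n z, z)) \<in> measurable ?L (lborel \<Otimes>\<^sub>M ?L)" by measurable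
      from measurable_compose[OF this measurable_compose[OF Rm K]] show ?thesis
        by (simp only: split_beta' fst_conv snd_conv)
    qed
    have "(\<integral>\<^sup>+z. K (?R (s / ray_mean n z) z) \<partial>ray_measure n)
      = (\<integral>\<^sup>+z. K (?R (s / ray_mean n z) z) * indicator ?P z \<partial>
          density ?L (\<lambda>z. ennreal (1 / \<bar>ray_mean n z\<bar> ^ n)))"
      unfolding ray_measure_def by (subst nn_integral_restrict_space) auto
    also have "\<dots> = (\<integral>\<^sup>+z. ennreal (1 / \<bar>ray_mean n z\<bar> ^ n) * (K (?R (s / ray_mean n z) z) * indicator ?P z) \<partial>?L)"
      by (intro nn_integral_density) measurable
    finally have eq: "(\<integral>\<^sup>+z. K (?R (s / ray_mean n z) z) \<partial>ray_measure n) =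
      (\<integral>\<^sup>+z. ennreal (1 / \<bar>ray_mean n z\<bar> ^ n) * (K (?R (s / ray_mean n z) z) * indicator ?P z) \<partial>?L)" .
    show "(\<integral>\<^sup>+z. ennreal (s ^ (n - 1)) * indicator {0<..} s *
      (ennreal (1 / \<bar>ray_mean n z\<bar> ^ n) * (K (?R (s / ray_mean n z) z) * indicator ?P z)) \<partial>?L)
      = ennreal (s ^ (n - 1)) * indicator {0<..} s *
        (\<integral>\<^sup>+z. K (\<lambda>i\<in>{1..n}. s * ray_point n z i) \<partial>ray_measure n)"
      unfolding ray eq by (intro nn_integral_cmult) measurable
  qed
  finally show ?thesis .
qed

section \<open>Affine majorants and products over points of mean 1\<close>

text \<open>Subtract the chord over \<open>{x..y}\<close>. The difference vanishes at both ends and is positive somewhere,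
  so its maximum is attained at an inner point \<open>s\<close>, and there the chord shifted upwards touches
  \<open>\<phi>\<close> from above.\<close>

lemma affine_majorant_at_point:
  fixes \<phi> :: "real \<Rightarrow> real"
  assumes cont: "continuous_on {0<..} \<phi>" and xy: "0 < x" "x < y" and u: "0 < u" "u < 1"
    and chord: "u * \<phi> x + (1 - u) * \<phi> y < \<phi> (u * x + (1 - u) * y)"
  obtains s \<kappa> \<delta> where "s > 0" "\<delta> > 0" "\<And>r. \<bar>r - s\<bar> < \<delta> \<Longrightarrow> \<phi> r \<le> \<phi> s + \<kappa> * (r - s)"
proof -
  define \<kappa> where "\<kappa> = (\<phi> y - \<phi> x) / (y - x)"
  define h where "h r = \<phi> r - \<phi> x - \<kappa> * (r - x)" for r
  have ends: "h x = 0" "h y = 0" using xy by (auto simp: h_def \<kappa>_def)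
  have "continuous_on {x..y} \<phi>" using xy by (intro continuous_on_subset[OF cont]) auto
  then have "continuous_on {x..y} h" unfolding h_def by (intro continuous_intros)
  then obtain s where s: "s \<in> {x..y}" "\<And>r. r \<in> {x..y} \<Longrightarrow> h r \<le> h s"
    using continuous_attains_sup[of "{x..y}" h] xy by auto
  define m where "m = u * x + (1 - u) * y"
  have mx: "m - x = (1 - u) * (y - x)" and my: "y - m = u * (y - x)"
    by (simp_all add: m_def algebra_simps)
  have "m - x > 0" "y - m > 0" using mx my u xy by auto
  then have "m \<in> {x..y}" by auto
  have "\<kappa> * (m - x) = (1 - u) * (\<phi> y - \<phi> x)"
    using xy by (simp add: \<kappa>_def mx)
  then have "h m > 0" using chord by (simp add: h_def m_def algebra_simps)
  then have "h s > 0" using s(2)[OF \<open>m \<in> {x..y}\<close>] by linarith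
  then have "s \<noteq> x" "s \<noteq> y" using ends by auto
  with s(1) have sxy: "x < s" "s < y" by auto
  show ?thesis
  proof (rule that[of s "min (s - x) (y - s)" \<kappa>])
    fix r assume "\<bar>r - s\<bar> < min (s - x) (y - s)"
    then have "r \<in> {x..y}" by auto
    from s(2)[OF this] show "\<phi> r \<le> \<phi> s + \<kappa> * (r - s)"
      by (simp add: h_def algebra_simps)
  qed (use sxy xy in auto)
qed

lemma ln_strictly_concave:
  fixes x y u :: real
  assumes "0 < x" "x < y" "0 < u" "u < 1"
  shows "u * ln x + (1 - u) * ln y < ln (u * x + (1 - u) * y)"
proof -
  define m where "m = u * x + (1 - u) * y"
  have m: "m > 0" using assms by (simp add: m_def add_pos_pos)
  have "m - x = (1 - u) * (y - x)" by (simp add: m_def algebra_simps)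
  then have "m \<noteq> x" using assms by auto
  have "ln (x / m) \<noteq> x / m - 1"
    using ln_eq_minus_one[of "x / m"] m assms \<open>m \<noteq> x\<close> by auto
  then have "ln (x / m) < x / m - 1"
    using ln_le_minus_one[of "x / m"] m assms by auto
  moreover have "ln (y / m) \<le> y / m - 1"
    using m assms by (intro ln_le_minus_one) auto
  ultimately have "u * ln (x / m) + (1 - u) * ln (y / m) < u * (x / m - 1) + (1 - u) * (y / m - 1)"
    using assms by (intro add_less_le_mono mult_strict_left_mono mult_left_mono) auto
  also have "\<dots> = (u * x + (1 - u) * y) / m - 1"
    using m by (simp add: field_simps)
  also have "\<dots> = 0" using m unfolding m_def[symmetric] by simp
  finally show ?thesis
    using m assms unfolding m_def[symmetric] by (simp add: ln_div algebra_simps)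
qed

text \<open>The inequality of arithmetic and geometric means in logarithmic form: \<open>ln v \<le> v - 1\<close>, with
  equality at \<open>v = 1\<close> only, and the right-hand sides add up to \<open>0\<close>.\<close>

lemma prod_powr_strict_antimono:
  fixes w :: "'i \<Rightarrow> real"
  assumes I: "finite I" and w: "\<And>i. i \<in> I \<Longrightarrow> w i > 0" "(\<Sum>i\<in>I. w i) = real (card I)" and "A < B"
  shows "(\<Prod>i\<in>I. w i powr B) \<le> (\<Prod>i\<in>I. w i powr A)"
    and "(\<exists>i\<in>I. w i \<noteq> 1) \<Longrightarrow> (\<Prod>i\<in>I. w i powr B) \<noteq> (\<Prod>i\<in>I. w i powr A)"
proof -
  have eq: "(\<Prod>i\<in>I. w i powr E) = exp (E * (\<Sum>i\<in>I. ln (w i)))" for E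
    using w I by (simp add: sum_distrib_left exp_sum powr_def)
       (intro prod.cong, auto dest: w(1))
  have zero: "(\<Sum>i\<in>I. w i - 1) = 0" using w by (simp add: sum_subtractf)
  have "(\<Sum>i\<in>I. ln (w i)) \<le> (\<Sum>i\<in>I. w i - 1)"
    using w by (intro sum_mono ln_le_minus_one) auto
  then have "(\<Sum>i\<in>I. ln (w i)) \<le> 0" using zero by simp
  then show "(\<Prod>i\<in>I. w i powr B) \<le> (\<Prod>i\<in>I. w i powr A)"
    unfolding eq using \<open>A < B\<close> by (simp add: mult_right_mono_neg)
  assume "\<exists>i\<in>I. w i \<noteq> 1"
  then obtain j where j: "j \<in> I" "w j \<noteq> 1" by blast
  have "(\<Sum>i\<in>I. ln (w i)) < (\<Sum>i\<in>I. w i - 1)"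
  proof (rule sum_strict_mono_ex1)
    have "ln (w j) \<noteq> w j - 1" using ln_eq_minus_one[OF w(1)[OF j(1)]] j(2) by blast
    moreover have "ln (w j) \<le> w j - 1" using w(1)[OF j(1)] by (rule ln_le_minus_one)
    ultimately show "\<exists>i\<in>I. ln (w i) < w i - 1" using j(1) by force
  qed (use w I ln_le_minus_one in auto)
  then show "(\<Prod>i\<in>I. w i powr B) \<noteq> (\<Prod>i\<in>I. w i powr A)"
    unfolding eq zero using \<open>A < B\<close> by auto
qed

text \<open>Adding the inequalities for \<open>ln (f (s * w i))\<close> over \<open>i\<close>, the affine term \<open>\<kappa> * s * (w i - 1)\<close>
  drops out because the \<open>w i\<close> have mean \<open>1\<close>.\<close>

lemma prod_le_of_affine_majorant:
  fixes f :: "real \<Rightarrow> real" and w :: "'i \<Rightarrow> real"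
  assumes I: "finite I" and w: "\<And>i. i \<in> I \<Longrightarrow> w i > 0" "(\<Sum>i\<in>I. w i) = real (card I)"
    and f: "\<And>x. x > 0 \<Longrightarrow> f x > 0" and "s > 0"
    and touch: "\<And>r. \<bar>r - s\<bar> < \<delta> \<Longrightarrow> ln (f r) - A * ln r \<le> ln (f s) - A * ln s + \<kappa> * (r - s)"
    and near: "\<And>i. i \<in> I \<Longrightarrow> \<bar>w i - 1\<bar> < \<delta> / s"
  shows "(\<Prod>i\<in>I. f (s * w i)) \<le> f s ^ card I * (\<Prod>i\<in>I. w i powr A)"
proof -
  have le: "f (s * w i) \<le> exp (ln (f s) + A * ln (w i) + \<kappa> * s * (w i - 1))" if i: "i \<in> I" for i
  proof -
    have "s * w i - s = s * (w i - 1)" by (simp add: right_diff_distrib)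
    then have "\<bar>s * w i - s\<bar> = s * \<bar>w i - 1\<bar>"
      using \<open>s > 0\<close> by (simp add: abs_mult)
    then have "\<bar>s * w i - s\<bar> < \<delta>" using near[OF i] \<open>s > 0\<close> by (simp add: field_simps)
    from touch[OF this] have "ln (f (s * w i)) \<le> ln (f s) + A * ln (w i) + \<kappa> * s * (w i - 1)"
      using \<open>s > 0\<close> w(1)[OF i] by (simp add: ln_mult algebra_simps)
    moreover have "f (s * w i) > 0" using f \<open>s > 0\<close> w(1)[OF i] by simp
    ultimately show ?thesis by (simp add: ln_ge_iff[symmetric] ln_le_cancel_iff[symmetric] del: ln_le_cancel_iff)
  qed
  have "(\<Prod>i\<in>I. f (s * w i)) \<le> (\<Prod>i\<in>I. exp (ln (f s) + A * ln (w i) + \<kappa> * s * (w i - 1)))"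
    using le f \<open>s > 0\<close> w(1) by (intro prod_mono) (auto intro: less_imp_le)
  also have "\<dots> = exp (\<Sum>i\<in>I. ln (f s) + A * ln (w i) + \<kappa> * s * (w i - 1))"
    using I by (simp add: exp_sum)
  also have "(\<Sum>i\<in>I. ln (f s) + A * ln (w i) + \<kappa> * s * (w i - 1))
      = (\<Sum>i\<in>I. ln (f s) + A * ln (w i))"
    using w(2) by (simp add: sum.distrib sum_distrib_left[symmetric] sum_subtractf)
  also have "exp \<dots> = (\<Prod>i\<in>I. f s * w i powr A)"
    using I f[OF \<open>s > 0\<close>] w(1) by (simp add: exp_sum exp_add powr_def)
       (intro prod.cong, auto dest: w(1))
  also have "\<dots> = f s ^ card I * (\<Prod>i\<in>I. w i powr A)" by (simp add: prod.distrib)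
  finally show ?thesis .
qed

section \<open>Averages over shrinking pieces of the simplex\<close>

text \<open>A sequence of finite measures on families \<open>w\<close> of mean \<open>1\<close> that contracts to the constant family
  \<open>1\<close> without being concentrated on it. Sampling the contraction at integer times, and keeping
  \<open>w\<close> in a compact interval from the start, makes every integral below finite. The condition
  \<open>off_diagonal\<close> is what makes the averages of powers strictly monotone in the exponent.\<close>

locale shrinking_simplex =
  fixes \<mu> :: "nat \<Rightarrow> 'z measure" and w :: "'i \<Rightarrow> 'z \<Rightarrow> real" and I :: "'i set"
  assumes finite_I: "finite I"
    and fin: "\<And>k. finite_measure (\<mu> k)"
    and w_meas: "\<And>i k. i \<in> I \<Longrightarrow> w i \<in> borel_measurable (\<mu> k)"
    and w_sum: "\<And>k z. z \<in> space (\<mu> k) \<Longrightarrow> (\<Sum>i\<in>I. w i z) = real (card I)"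
    and w_near: "\<And>i k z. i \<in> I \<Longrightarrow> z \<in> space (\<mu> k) \<Longrightarrow> w i z \<in> {1/2..3/2}"
    and w_tendsto: "\<And>\<delta>. \<delta> > 0 \<Longrightarrow>
        eventually (\<lambda>k. \<forall>z\<in>space (\<mu> k). \<forall>i\<in>I. \<bar>w i z - 1\<bar> < \<delta>) sequentially"
    and off_diagonal: "\<And>k. emeasure (\<mu> k) {z \<in> space (\<mu> k). \<exists>i\<in>I. w i z \<noteq> 1} > 0"
begin

definition avg :: "(real \<Rightarrow> real) \<Rightarrow> nat \<Rightarrow> real \<Rightarrow> real" where
  "avg f k s = (\<integral>z. (\<Prod>i\<in>I. f (s * w i z)) \<partial>\<mu> k)"

lemma w_pos: "i \<in> I \<Longrightarrow> z \<in> space (\<mu> k) \<Longrightarrow> w i z > 0"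
  using w_near[of i z k] by auto

lemma prod_measurable:
  fixes f :: "real \<Rightarrow> real"
  assumes [measurable]: "f \<in> borel_measurable borel"
  shows "(\<lambda>z. \<Prod>i\<in>I. f (s * w i z)) \<in> borel_measurable (\<mu> k)"
proof (rule borel_measurable_prod)
  fix i assume "i \<in> I"
  then have [measurable]: "w i \<in> borel_measurable (\<mu> k)" by (rule w_meas)
  show "(\<lambda>z. f (s * w i z)) \<in> borel_measurable (\<mu> k)" by measurable
qed

lemma prod_bounded:
  assumes cont: "continuous_on {0<..} (f :: real \<Rightarrow> real)" and "0 < a"
  obtains B where "\<And>s k z. s \<in> {a..b} \<Longrightarrow> z \<in> space (\<mu> k) \<Longrightarrow> \<bar>\<Prod>i\<in>I. f (s * w i z)\<bar> \<le> B"
proof -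
  have "compact (f ` {a / 2..3 * b / 2})"
    using \<open>0 < a\<close> by (intro compact_continuous_image continuous_on_subset[OF cont]) auto
  then obtain B where B: "\<And>x. x \<in> {a / 2..3 * b / 2} \<Longrightarrow> \<bar>f x\<bar> \<le> B"
    using compact_imp_bounded[THEN bounded_iff[THEN iffD1]] by force
  have "\<bar>\<Prod>i\<in>I. f (s * w i z)\<bar> \<le> B ^ card I" if "s \<in> {a..b}" "z \<in> space (\<mu> k)" for s k z
  proof -
    have "s * w i z \<in> {a / 2..3 * b / 2}" if "i \<in> I" for i
    proof -
      have "a * (1/2) \<le> s * w i z"
        using w_near[OF that \<open>z \<in> _\<close>] \<open>s \<in> {a..b}\<close> \<open>0 < a\<close> by (intro mult_mono) auto
      moreover have "s * w i z \<le> b * (3/2)"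
        using w_near[OF that \<open>z \<in> _\<close>] \<open>s \<in> {a..b}\<close> \<open>0 < a\<close> by (intro mult_mono) auto
      ultimately show ?thesis by simp
    qed
    then have "(\<Prod>i\<in>I. \<bar>f (s * w i z)\<bar>) \<le> (\<Prod>i\<in>I. B)"
      using B by (intro prod_mono) auto
    then show ?thesis by (simp add: abs_prod)
  qed
  then show ?thesis by (rule that)
qed

lemma prod_integrable:
  fixes f :: "real \<Rightarrow> real"
  assumes "f \<in> borel_measurable borel" "continuous_on {0<..} f" "s > 0"
  shows "integrable (\<mu> k) (\<lambda>z. \<Prod>i\<in>I. f (s * w i z))"
proof -
  interpret finite_measure "\<mu> k" by (rule fin)
  obtain B where "\<And>z. z \<in> space (\<mu> k) \<Longrightarrow> \<bar>\<Prod>i\<in>I. f (s * w i z)\<bar> \<le> B"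
    using prod_bounded[OF assms(2,3), of s] by (metis atLeastAtMost_iff order_refl)
  then show ?thesis
    by (intro integrable_const_bound[where B=B] prod_measurable assms) auto
qed

lemma avg_continuous:
  assumes f: "f \<in> borel_measurable borel" and cont: "continuous_on {0<..} f"
  shows "continuous_on {0<..} (avg f k)"
proof -
  interpret finite_measure "\<mu> k" by (rule fin)
  have "isCont (avg f k) s" if "s > 0" for s
  proof -
    have "s / 2 > 0" using that by simp
    obtain B where B: "\<And>r k z. r \<in> {s / 2..2 * s} \<Longrightarrow> z \<in> space (\<mu> k) \<Longrightarrow> \<bar>\<Prod>i\<in>I. f (r * w i z)\<bar> \<le> B"
      by (rule prod_bounded[OF cont \<open>s / 2 > 0\<close>, of "2 * s"]) blast
    have "continuous_on {s / 2..2 * s} (avg f k)"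
    proof (unfold continuous_on_sequentially, intro allI ballI impI, elim conjE)
      fix x a assume x: "\<forall>m. x m \<in> {s / 2..2 * s}" and lim: "x \<longlonglongrightarrow> a" and a: "a \<in> {s / 2..2 * s}"
      show "(avg f k \<circ> x) \<longlonglongrightarrow> avg f k a"
        unfolding comp_def avg_def
      proof (rule integral_dominated_convergence[where w="\<lambda>_. B"])
        show "AE z in \<mu> k. (\<lambda>m. \<Prod>i\<in>I. f (x m * w i z)) \<longlonglongrightarrow> (\<Prod>i\<in>I. f (a * w i z))"
        proof (rule AE_I2, rule tendsto_prod)
          fix z i assume z: "z \<in> space (\<mu> k)" and i: "i \<in> I"
          have "a * w i z > 0" using w_pos[OF i z] a that by auto
          then have "isCont f (a * w i z)"
            using cont by (simp add: continuous_on_eq_continuous_at)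
          then show "(\<lambda>m. f (x m * w i z)) \<longlonglongrightarrow> f (a * w i z)"
            by (rule isCont_tendsto_compose) (intro tendsto_intros lim)
        qed
        show "AE z in \<mu> k. norm (\<Prod>i\<in>I. f (x m * w i z)) \<le> B" for m
          using B[of "x m"] x by auto
      qed (auto intro: prod_measurable f)
    qed
    then show ?thesis
      using that by (intro continuous_on_interior) (auto simp: interior_atLeastAtMost_real)
  qed
  then show ?thesis by (simp add: continuous_at_imp_continuous_on)
qed

lemma volume_pos: "measure (\<mu> k) (space (\<mu> k)) > 0"
proof -
  interpret finite_measure "\<mu> k" by (rule fin)
  have "emeasure (\<mu> k) {z \<in> space (\<mu> k). \<exists>i\<in>I. w i z \<noteq> 1} \<le> emeasure (\<mu> k) (space (\<mu> k))"
    by (intro emeasure_mono) auto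
  then have "emeasure (\<mu> k) (space (\<mu> k)) > 0" using off_diagonal[of k] by auto
  then show ?thesis by (simp add: emeasure_eq_measure)
qed

text \<open>By continuity all factors \<open>f (s * w i z)\<close> lie between \<open>(1 - \<eta>) * f s\<close> and \<open>(1 + \<eta>) * f s\<close> once the
  measures are close enough to the constant family.\<close>

lemma avg_tendsto:
  assumes f: "f \<in> borel_measurable borel" "continuous_on {0<..} f" "\<And>x. x > 0 \<Longrightarrow> f x > 0"
    and s: "s > 0"
  shows "(\<lambda>k. avg f k s / measure (\<mu> k) (space (\<mu> k))) \<longlonglongrightarrow> f s ^ card I"
proof -
  have *: "eventually (\<lambda>k. avg f k s / measure (\<mu> k) (space (\<mu> k))
      \<in> {((1 - \<eta>) * f s) ^ card I .. ((1 + \<eta>) * f s) ^ card I}) sequentially"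
    if \<eta>: "0 < \<eta>" "\<eta> < 1" for \<eta>
  proof -
    have "isCont f s" using f(2) s by (simp add: continuous_on_eq_continuous_at)
    moreover have "\<eta> * f s > 0" using f(3)[OF s] \<eta> by simp
    ultimately obtain d where d: "d > 0" "\<And>x. \<bar>x - s\<bar> < d \<Longrightarrow> \<bar>f x - f s\<bar> < \<eta> * f s"
      unfolding continuous_at_eps_delta dist_real_def by blast
    show ?thesis
    proof (rule eventually_mono[OF w_tendsto[of "d / s"]])
      fix k assume k: "\<forall>z\<in>space (\<mu> k). \<forall>i\<in>I. \<bar>w i z - 1\<bar> < d / s"
      interpret finite_measure "\<mu> k" by (rule fin)
      have b: "(1 - \<eta>) * f s \<le> f (s * w i z) \<and> f (s * w i z) \<le> (1 + \<eta>) * f s"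
        if "z \<in> space (\<mu> k)" "i \<in> I" for z i
      proof -
        have "s * w i z - s = s * (w i z - 1)" by (simp add: right_diff_distrib)
        then have "\<bar>s * w i z - s\<bar> = s * \<bar>w i z - 1\<bar>"
          using s by (simp add: abs_mult)
        also have "\<dots> < d" using k that s by (simp add: field_simps)
        finally have "\<bar>f (s * w i z) - f s\<bar> < \<eta> * f s" by (rule d(2))
        then show ?thesis by (simp add: algebra_simps abs_less_iff)
      qed
      have P: "((1 - \<eta>) * f s) ^ card I \<le> (\<Prod>i\<in>I. f (s * w i z))"
        "(\<Prod>i\<in>I. f (s * w i z)) \<le> ((1 + \<eta>) * f s) ^ card I" if z: "z \<in> space (\<mu> k)" for z
      proof -
        have nn: "0 \<le> (1 - \<eta>) * f s" using f(3)[OF s] \<eta> by simp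
        have "(\<Prod>i\<in>I. (1 - \<eta>) * f s) \<le> (\<Prod>i\<in>I. f (s * w i z))"
          using b[OF z] nn by (intro prod_mono) auto
        moreover have "(\<Prod>i\<in>I. f (s * w i z)) \<le> (\<Prod>i\<in>I. (1 + \<eta>) * f s)"
          using b[OF z] nn order_trans[OF nn] by (intro prod_mono) auto
        ultimately show "((1 - \<eta>) * f s) ^ card I \<le> (\<Prod>i\<in>I. f (s * w i z))"
          "(\<Prod>i\<in>I. f (s * w i z)) \<le> ((1 + \<eta>) * f s) ^ card I" by simp_all
      qed
      have "(\<integral>z. ((1 - \<eta>) * f s) ^ card I \<partial>\<mu> k) \<le> avg f k s"
        unfolding avg_def using P by (intro integral_mono prod_integrable f s) auto
      moreover have "avg f k s \<le> (\<integral>z. ((1 + \<eta>) * f s) ^ card I \<partial>\<mu> k)"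
        unfolding avg_def using P by (intro integral_mono prod_integrable f s) auto
      ultimately show "avg f k s / measure (\<mu> k) (space (\<mu> k))
          \<in> {((1 - \<eta>) * f s) ^ card I .. ((1 + \<eta>) * f s) ^ card I}"
        using volume_pos[of k] by (simp add: field_simps)
    qed (use d s in auto)
  qed
  have pick: "\<exists>\<eta>. 0 < \<eta> \<and> \<eta> < 1 \<and> P (\<eta>::real)" if "eventually P (at_right 0)" for P
  proof -
    have "eventually (\<lambda>\<eta>::real. \<eta> \<in> {0<..<1}) (at_right 0)"
      by (rule eventually_at_right_real) simp
    with that have "eventually (\<lambda>\<eta>::real. 0 < \<eta> \<and> \<eta> < 1 \<and> P \<eta>) (at_right 0)"
      by eventually_elim auto
    then show ?thesis using eventually_happens'[of "at_right (0::real)"] by auto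
  qed
  have lim: "((\<lambda>\<eta>. ((1 - \<eta>) * f s) ^ card I) \<longlongrightarrow> ((1 - 0) * f s) ^ card I) (at_right 0)"
    "((\<lambda>\<eta>. ((1 + \<eta>) * f s) ^ card I) \<longlongrightarrow> ((1 + 0) * f s) ^ card I) (at_right 0)"
    by (intro tendsto_intros)+
  show ?thesis
  proof (rule order_tendstoI)
    fix c assume "c < f s ^ card I"
    with order_tendstoD(1)[OF lim(1), of c]
    obtain \<eta> where "0 < \<eta>" "\<eta> < 1" "c < ((1 - \<eta>) * f s) ^ card I" using pick by auto
    with *[of \<eta>] show "eventually (\<lambda>k. c < avg f k s / measure (\<mu> k) (space (\<mu> k))) sequentially"
      by (auto elim: eventually_mono)
  next
    fix c assume "f s ^ card I < c"
    with order_tendstoD(2)[OF lim(2), of c]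
    obtain \<eta> where "0 < \<eta>" "\<eta> < 1" "((1 + \<eta>) * f s) ^ card I < c" using pick by auto
    with *[of \<eta>] show "eventually (\<lambda>k. avg f k s / measure (\<mu> k) (space (\<mu> k)) < c) sequentially"
      by (auto elim: eventually_mono)
  qed
qed

definition power_avg :: "real \<Rightarrow> nat \<Rightarrow> real" where
  "power_avg A k = (\<integral>z. (\<Prod>i\<in>I. w i z powr A) \<partial>\<mu> k)"

lemma power_prod_integrable: "integrable (\<mu> k) (\<lambda>z. \<Prod>i\<in>I. w i z powr A)"
proof -
  have "continuous_on {0<..} (\<lambda>x::real. x powr A)"
    by (intro continuous_intros) auto
  then show ?thesis using prod_integrable[of "\<lambda>x. x powr A" 1 k] by simp
qed

lemma power_avg_strict_antimono:
  assumes "A < B"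
  shows "power_avg B k < power_avg A k"
proof -
  interpret finite_measure "\<mu> k" by (rule fin)
  have [measurable]: "Measurable.pred (\<mu> k) (\<lambda>z. \<exists>i\<in>I. w i z \<noteq> 1)"
    using w_meas finite_I by measurable
  show ?thesis
    unfolding power_avg_def
  proof (rule integral_less_AE[where A="{z \<in> space (\<mu> k). \<exists>i\<in>I. w i z \<noteq> 1}"])
    show "AE z in \<mu> k. (\<Prod>i\<in>I. w i z powr B) \<le> (\<Prod>i\<in>I. w i z powr A)"
      using prod_powr_strict_antimono(1)[OF finite_I w_pos w_sum \<open>A < B\<close>] by auto
    show "AE z in \<mu> k. z \<in> {z \<in> space (\<mu> k). \<exists>i\<in>I. w i z \<noteq> 1} \<longrightarrow>
        (\<Prod>i\<in>I. w i z powr B) \<noteq> (\<Prod>i\<in>I. w i z powr A)"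
      using prod_powr_strict_antimono(2)[OF finite_I w_pos w_sum \<open>A < B\<close>] by auto
    show "emeasure (\<mu> k) {z \<in> space (\<mu> k). \<exists>i\<in>I. w i z \<noteq> 1} \<noteq> 0"
      using off_diagonal[of k] by auto
  qed (auto intro: power_prod_integrable)
qed

text \<open>The maximum principle: exceeding a chord somewhere forces domination by a pure power of \<open>w\<close> at
  some point \<open>s\<close>, for all sufficiently contracted measures.\<close>

lemma eventually_prod_le:
  assumes cont: "continuous_on {0<..} f" and pos: "\<And>x. x > 0 \<Longrightarrow> f x > 0"
    and xy: "0 < x" "x < y" and u: "0 < u" "u < 1"
    and chord: "u * (ln (f x) - A * ln x) + (1 - u) * (ln (f y) - A * ln y)
      < ln (f (u * x + (1 - u) * y)) - A * ln (u * x + (1 - u) * y)"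
  obtains s where "s > 0" "eventually (\<lambda>k. \<forall>z\<in>space (\<mu> k).
      (\<Prod>i\<in>I. f (s * w i z)) \<le> f s ^ card I * (\<Prod>i\<in>I. w i z powr A)) sequentially"
proof -
  have "continuous_on {0<..} (\<lambda>r. ln (f r) - A * ln r)"
    using pos by (intro continuous_intros cont) (auto simp: less_imp_neq[symmetric])
  then obtain s \<kappa> \<delta> where s: "s > 0" "\<delta> > 0"
    "\<And>r. \<bar>r - s\<bar> < \<delta> \<Longrightarrow> ln (f r) - A * ln r \<le> ln (f s) - A * ln s + \<kappa> * (r - s)"
    using affine_majorant_at_point[OF _ xy u chord] by metis
  show ?thesis
  proof (rule that[OF s(1)])
    have "\<delta> / s > 0" using s by simp
    show "eventually (\<lambda>k. \<forall>z\<in>space (\<mu> k).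
      (\<Prod>i\<in>I. f (s * w i z)) \<le> f s ^ card I * (\<Prod>i\<in>I. w i z powr A)) sequentially"
    proof (rule eventually_mono[OF w_tendsto[OF \<open>\<delta> / s > 0\<close>]], intro ballI)
      fix k z assume "\<forall>z\<in>space (\<mu> k). \<forall>i\<in>I. \<bar>w i z - 1\<bar> < \<delta> / s" and z: "z \<in> space (\<mu> k)"
      then show "(\<Prod>i\<in>I. f (s * w i z)) \<le> f s ^ card I * (\<Prod>i\<in>I. w i z powr A)"
        using s by (intro prod_le_of_affine_majorant[where \<delta>=\<delta> and \<kappa>=\<kappa>] finite_I pos w_sum) (auto intro: w_pos)
    qed
  qed
qed

text \<open>A factorization of the averages determines \<open>f\<close>: comparison with the averages of powers shows that
  the exponent at which \<open>ln f - A ln\<close> meets a given chord at a given inner point is the same for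
  all chords and points.\<close>

theorem power_exponential_of_factorization:
  assumes f: "f \<in> borel_measurable borel" and cont: "continuous_on {0<..} f"
    and pos: "\<And>x. x > 0 \<Longrightarrow> f x > 0"
    and factor: "\<And>k s. s > 0 \<Longrightarrow> avg f k s = q k * R s"
  shows "\<exists>A \<beta> C. C > 0 \<and> (\<forall>s>0. f s = C * s powr A * exp (- \<beta> * s))"
proof -
  let ?n = "card I"
  \<comment> \<open>Contraction to the constant family identifies \<open>R s\<close> with \<open>f s ^ ?n\<close>, up to the factor \<open>\<gamma>\<close>.\<close>
  obtain c where c: "avg f k s = c k * f s ^ ?n" if "s > 0" for k s
  proof -
    define Q where "Q k = q k / measure (\<mu> k) (space (\<mu> k))" for k
    have lim: "(\<lambda>k. Q k * R s) \<longlonglongrightarrow> f s ^ ?n" if "s > 0" for s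
      using avg_tendsto[OF f cont pos that] by (simp add: factor[OF that] Q_def)
    have "R 1 \<noteq> 0"
    proof
      assume "R 1 = 0"
      with lim[of 1] have "(\<lambda>k. 0) \<longlonglongrightarrow> f 1 ^ ?n" by simp
      then have "f 1 ^ ?n = 0" by (simp add: LIMSEQ_const_iff)
      then show False using pos[of 1] by simp
    qed
    define \<gamma> where "\<gamma> = f 1 ^ ?n / R 1"
    have "(\<lambda>k. Q k * R 1 / R 1) \<longlonglongrightarrow> f 1 ^ ?n / R 1"
      using \<open>R 1 \<noteq> 0\<close> by (intro tendsto_intros lim) auto
    then have Q: "Q \<longlonglongrightarrow> \<gamma>" using \<open>R 1 \<noteq> 0\<close> by (simp add: \<gamma>_def)
    have "\<gamma> * R s = f s ^ ?n" if "s > 0" for s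
      using LIMSEQ_unique[OF tendsto_mult[OF Q tendsto_const] lim[OF that]] .
    moreover have "\<gamma> \<noteq> 0" using pos[of 1] \<open>R 1 \<noteq> 0\<close> by (simp add: \<gamma>_def)
    ultimately have "avg f k s = q k / \<gamma> * f s ^ ?n" if "s > 0" for k s
      using factor[OF that] that by (simp add: field_simps)
    then show ?thesis by (rule that)
  qed
  \<comment> \<open>The gap of \<open>ln f - A ln\<close> below the chord over \<open>{x..y}\<close> is \<open>G x y u + A * L x y u\<close>: affine and
    strictly increasing in \<open>A\<close>.\<close>
  define G where "G x y u = u * ln (f x) + (1 - u) * ln (f y) - ln (f (u * x + (1 - u) * y))" for x y u
  define L where "L x y u = ln (u * x + (1 - u) * y) - (u * ln x + (1 - u) * ln y)" for x y u :: real
  have L: "L x y u > 0" if "0 < x" "x < y" "0 < u" "u < 1" for x y u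
    using ln_strictly_concave[OF that] by (simp add: L_def)
  have upper: "eventually (\<lambda>k. c k \<le> power_avg A k) sequentially"
    if t: "0 < x" "x < y" "0 < u" "u < 1" and "G x y u + A * L x y u < 0" for x y u A
  proof -
    have "u * (ln (f x) - A * ln x) + (1 - u) * (ln (f y) - A * ln y)
      < ln (f (u * x + (1 - u) * y)) - A * ln (u * x + (1 - u) * y)"
      using that by (simp add: G_def L_def algebra_simps)
    then obtain s where s: "s > 0" and ev: "eventually (\<lambda>k. \<forall>z\<in>space (\<mu> k).
      (\<Prod>i\<in>I. f (s * w i z)) \<le> f s ^ ?n * (\<Prod>i\<in>I. w i z powr A)) sequentially"
      using eventually_prod_le[OF cont pos t] by blast
    from ev show ?thesis
    proof eventually_elim
      case (elim k)
      have "avg f k s \<le> (\<integral>z. f s ^ ?n * (\<Prod>i\<in>I. w i z powr A) \<partial>\<mu> k)"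
        unfolding avg_def using elim
        by (intro integral_mono prod_integrable f cont s integrable_mult_right power_prod_integrable) auto
      then have "c k * f s ^ ?n \<le> power_avg A k * f s ^ ?n"
        using c[OF s, of k] by (simp add: power_avg_def mult.commute)
      then show ?case using pos[OF s] by simp
    qed
  qed
  \<comment> \<open>The reverse comparison is the previous one for \<open>1 / f\<close> and \<open>- A\<close>.\<close>
  have lower: "eventually (\<lambda>k. power_avg A k \<le> c k) sequentially"
    if t: "0 < x" "x < y" "0 < u" "u < 1" and "0 < G x y u + A * L x y u" for x y u A
  proof -
    have m: "u * x + (1 - u) * y > 0" using t by (simp add: add_pos_pos)
    have y: "y > 0" using t by simp
    have "u * (ln (1 / f x) - (- A) * ln x) + (1 - u) * (ln (1 / f y) - (- A) * ln y)
      < ln (1 / f (u * x + (1 - u) * y)) - (- A) * ln (u * x + (1 - u) * y)"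
      using that t(1) pos[OF m] pos[OF y] pos[of x] by (simp add: G_def L_def ln_div algebra_simps)
    moreover have "continuous_on {0<..} (\<lambda>x. 1 / f x)"
      using pos by (intro continuous_intros cont) (auto simp: less_imp_neq[symmetric])
    ultimately obtain s where s: "s > 0" and ev: "eventually (\<lambda>k. \<forall>z\<in>space (\<mu> k).
      (\<Prod>i\<in>I. 1 / f (s * w i z)) \<le> (1 / f s) ^ ?n * (\<Prod>i\<in>I. w i z powr (- A))) sequentially"
      using eventually_prod_le[of "\<lambda>x. 1 / f x" x y u "- A"] pos t by auto
    from ev show ?thesis
    proof eventually_elim
      case (elim k)
      have "f s ^ ?n * (\<Prod>i\<in>I. w i z powr A) \<le> (\<Prod>i\<in>I. f (s * w i z))" if z: "z \<in> space (\<mu> k)" for z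
      proof -
        have "(\<Prod>i\<in>I. f (s * w i z)) > 0"
          using pos s w_pos[OF _ z] by (intro prod_pos) auto
        moreover have "(\<Prod>i\<in>I. w i z powr A) > 0"
          using w_pos[OF _ z] by (intro prod_pos) (auto simp: less_imp_neq[symmetric])
        moreover have "1 / (\<Prod>i\<in>I. f (s * w i z)) \<le> 1 / (f s ^ ?n * (\<Prod>i\<in>I. w i z powr A))"
          using elim z by (auto simp: prod_dividef powr_minus_divide power_one_over)
        moreover have "f s ^ ?n > 0" using pos[OF s] by simp
        ultimately show ?thesis by (simp add: field_simps)
      qed
      then have "(\<integral>z. f s ^ ?n * (\<Prod>i\<in>I. w i z powr A) \<partial>\<mu> k) \<le> avg f k s"
        unfolding avg_def
        by (intro integral_mono prod_integrable f cont s integrable_mult_right power_prod_integrable) auto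
      then have "power_avg A k * f s ^ ?n \<le> c k * f s ^ ?n"
        using c[OF s, of k] by (simp add: power_avg_def mult.commute)
      then show ?case using pos[OF s] by simp
    qed
  qed
  \<comment> \<open>The exponent at which the gap closes.\<close>
  define r where "r x y u = - G x y u / L x y u" for x y u
  have r_le: "r x y u \<le> r x' y' u'"
    if t: "0 < x" "x < y" "0 < u" "u < 1" and t': "0 < x'" "x' < y'" "0 < u'" "u' < 1"
    for x y u x' y' u'
  proof (rule ccontr)
    assume "\<not> r x y u \<le> r x' y' u'"
    \<comment> \<open>Two exponents strictly in between: the first triple bounds \<open>c\<close> above by the averages at the
      larger one, the second bounds it below by those at the smaller one.\<close>
    then obtain A where A: "r x' y' u' < A" "A < r x y u" using dense[of "r x' y' u'" "r x y u"] by auto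
    then obtain B where B: "A < B" "B < r x y u" using dense by blast
    have "G x y u + B * L x y u < 0" using B(2) L[OF t] by (simp add: r_def field_simps)
    note up = upper[OF t this]
    have "0 < G x' y' u' + A * L x' y' u'" using A(1) L[OF t'] by (simp add: r_def field_simps)
    note lo = lower[OF t' this]
    have "eventually (\<lambda>k. False) sequentially"
      using up lo
    proof eventually_elim
      case (elim k)
      then show ?case using power_avg_strict_antimono[OF B(1), of k] by linarith
    qed
    then show False by simp
  qed
  define A where "A = r 1 2 (1/2)"
  define \<phi> where "\<phi> x = ln (f x) - A * ln x" for x
  have affine: "\<phi> (u * x + (1 - u) * y) = u * \<phi> x + (1 - u) * \<phi> y"
    if t: "0 < x" "x < y" "0 < u" "u < 1" for x y u
  proof -
    have "r x y u = A"
      unfolding A_def using t by (intro antisym r_le) auto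
    then have "G x y u + A * L x y u = 0" using L[OF t] by (simp add: r_def field_simps)
    then show ?thesis by (simp add: G_def L_def \<phi>_def algebra_simps)
  qed
  \<comment> \<open>The points \<open>1\<close>, \<open>2\<close>, \<open>s\<close> in increasing order are a chord with a marked inner point.\<close>
  have line: "\<phi> s = \<phi> 1 + (\<phi> 2 - \<phi> 1) * (s - 1)" if "s > 0" for s
  proof -
    consider "s = 1" | "s = 2" | "s < 1" | "1 < s" "s < 2" | "2 < s" by linarith
    then show ?thesis
    proof cases
      case 3
      define e where "e = 1 / (2 - s)"
      have e: "e * (2 - s) = 1" "0 < e" "e < 1" using 3 by (auto simp: e_def)
      have one: "e * s + (1 - e) * 2 = 1" using e(1) by (simp add: algebra_simps)
      have "\<phi> (e * s + (1 - e) * 2) = e * \<phi> s + (1 - e) * \<phi> 2"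
        using 3 that e by (intro affine) auto
      then have "(2 - s) * \<phi> 1 = (2 - s) * (e * \<phi> s + (1 - e) * \<phi> 2)" unfolding one by simp
      also have "\<dots> = (e * (2 - s)) * \<phi> s + ((2 - s) - e * (2 - s)) * \<phi> 2"
        by (simp add: algebra_simps)
      finally show ?thesis unfolding e(1) by (simp add: algebra_simps)
    next
      case 4
      have "(2 - s) * 1 + (1 - (2 - s)) * 2 = s" by simp
      with affine[of 1 2 "2 - s"] 4 have "\<phi> s = (2 - s) * \<phi> 1 + (1 - (2 - s)) * \<phi> 2" by simp
      then show ?thesis by (simp add: algebra_simps)
    next
      case 5
      define e where "e = 1 / (s - 1)"
      have e: "e * (s - 1) = 1" "0 < e" "e < 1" using 5 by (auto simp: e_def)
      have two: "(1 - e) * 1 + (1 - (1 - e)) * s = 2" using e(1) by (simp add: algebra_simps)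
      have "\<phi> ((1 - e) * 1 + (1 - (1 - e)) * s) = (1 - e) * \<phi> 1 + (1 - (1 - e)) * \<phi> s"
        using 5 e by (intro affine) auto
      then have "(s - 1) * \<phi> 2 = (s - 1) * ((1 - e) * \<phi> 1 + (1 - (1 - e)) * \<phi> s)"
        unfolding two by simp
      also have "\<dots> = ((s - 1) - e * (s - 1)) * \<phi> 1 + (e * (s - 1)) * \<phi> s"
        by (simp add: algebra_simps)
      finally show ?thesis unfolding e(1) by (simp add: algebra_simps)
    qed auto
  qed
  have "f s = exp (2 * \<phi> 1 - \<phi> 2) * s powr A * exp (- (\<phi> 1 - \<phi> 2) * s)" if "s > 0" for s
  proof -
    have "ln (f s) = (2 * \<phi> 1 - \<phi> 2) + A * ln s + - (\<phi> 1 - \<phi> 2) * s"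
      using line[OF that] unfolding \<phi>_def[of s] by (simp add: algebra_simps)
    then have "exp (ln (f s)) = exp (2 * \<phi> 1 - \<phi> 2) * exp (A * ln s) * exp (- (\<phi> 1 - \<phi> 2) * s)"
      by (simp only: exp_add)
    then show ?thesis using pos[OF that] that by (simp add: powr_def)
  qed
  then show ?thesis by (intro exI[of _ A] exI[of _ "\<phi> 1 - \<phi> 2"] exI[of _ "exp (2 * \<phi> 1 - \<phi> 2)"]) auto
qed

end

section \<open>Product densities and points on rays\<close>

lemma PiM_density_lborel:
  fixes g :: "real \<Rightarrow> ennreal" and I :: "nat set"
  assumes I: "finite I" and g[measurable]: "g \<in> borel_measurable borel"
    and "sigma_finite_measure (density lborel g)"
  shows "PiM I (\<lambda>_. density lborel g) = density (PiM I (\<lambda>_. lborel)) (\<lambda>x. \<Prod>i\<in>I. g (x i))"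
proof -
  interpret D: product_sigma_finite "\<lambda>_::nat. density lborel g"
    using assms(3) by (simp add: product_sigma_finite_def)
  show ?thesis
  proof (rule D.PiM_eqI[symmetric])
    show "finite I" by (rule I)
    show "sets (density (PiM I (\<lambda>_. lborel)) (\<lambda>x. \<Prod>i\<in>I. g (x i))) = sets (PiM I (\<lambda>_. density lborel g))"
      by (simp cong: sets_PiM_cong)
    fix A :: "nat \<Rightarrow> real set" assume A: "\<And>i. i \<in> I \<Longrightarrow> A i \<in> sets (density lborel g)"
    then have PiE: "Pi\<^sub>E I A \<in> sets (PiM I (\<lambda>_. lborel))" using I by (intro sets_PiM_I_finite) auto
    have "emeasure (density (PiM I (\<lambda>_. lborel)) (\<lambda>x. \<Prod>i\<in>I. g (x i))) (Pi\<^sub>E I A)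
        = (\<integral>\<^sup>+x. (\<Prod>i\<in>I. g (x i)) * indicator (Pi\<^sub>E I A) x \<partial>PiM I (\<lambda>_. lborel))"
      using PiE by (intro emeasure_density) auto
    also have "\<dots> = (\<integral>\<^sup>+x. (\<Prod>i\<in>I. g (x i) * indicator (A i) (x i)) \<partial>PiM I (\<lambda>_. lborel))"
    proof (rule nn_integral_cong)
      fix x assume x: "x \<in> space (PiM I (\<lambda>_. lborel :: real measure))"
      have "indicator (Pi\<^sub>E I A) x = (\<Prod>i\<in>I. indicator (A i) (x i) :: ennreal)"
      proof (cases "x \<in> Pi\<^sub>E I A")
        case True
        then show ?thesis by (auto simp: PiE_iff intro!: prod.neutral[symmetric])
      next
        case False
        then obtain i where "i \<in> I" "x i \<notin> A i" using x by (auto simp: PiE_iff space_PiM)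
        then show ?thesis using False I by (auto intro!: prod_zero[symmetric] bexI[of _ i])
      qed
      then show "(\<Prod>i\<in>I. g (x i)) * indicator (Pi\<^sub>E I A) x = (\<Prod>i\<in>I. g (x i) * indicator (A i) (x i))"
        by (simp add: prod.distrib)
    qed
    also have "\<dots> = (\<Prod>i\<in>I. \<integral>\<^sup>+x. g x * indicator (A i) x \<partial>lborel)"
      using A I by (intro lborels.product_nn_integral_prod) auto
    also have "\<dots> = (\<Prod>i\<in>I. emeasure (density lborel g) (A i))"
      using A by (intro prod.cong refl emeasure_density[symmetric]) auto
    finally show "emeasure (density (PiM I (\<lambda>_. lborel)) (\<lambda>x. \<Prod>i\<in>I. g (x i))) (Pi\<^sub>E I A)
        = (\<Prod>i\<in>I. emeasure (density lborel g) (A i))" .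
  qed
qed

lemma space_ray_measure:
  "z \<in> space (ray_measure n) \<longleftrightarrow>
    z \<in> space (PiM {1..<n} (\<lambda>_. lborel)) \<and> (\<forall>i\<in>{1..<n}. z i > 0)"
  by (auto simp: ray_measure_def space_restrict_space)

lemma ray_point_pos:
  assumes "n \<ge> 1" "z \<in> space (ray_measure n)" "i \<in> {1..n}"
  shows "ray_point n z i > 0"
proof -
  have "ray_mean n z > 0" using assms by (intro ray_mean_pos) (auto simp: space_ray_measure)
  moreover have "(z(n := 1)) i > 0" using assms by (cases "i = n") (auto simp: space_ray_measure)
  ultimately show ?thesis using assms unfolding ray_point_def by simp
qed

lemma ray_point_sum:
  assumes "n \<ge> 1" "z \<in> space (ray_measure n)"
  shows "(\<Sum>i=1..n. ray_point n z i) = real n"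
proof -
  have m: "ray_mean n z > 0" using assms by (intro ray_mean_pos) (auto simp: space_ray_measure)
  have "(\<Sum>i=1..n. (z(n := 1)) i) = 1 + (\<Sum>i\<in>{1..<n}. z i)"
    unfolding insert_last[OF assms(1)] by (simp add: sum.insert)
  also have "\<dots> = real n * ray_mean n z" using assms(1) by (simp add: ray_mean_def)
  finally show ?thesis
    using m by (simp add: ray_point_def sum_divide_distrib[symmetric])
qed

lemma ray_point_measurable:
  assumes "i \<in> {1..n}"
  shows "(\<lambda>z. ray_point n z i) \<in> borel_measurable (ray_measure n)"
proof -
  have "(\<lambda>z. (z(n := 1)) i) \<in> borel_measurable (PiM {1..<n} (\<lambda>_. lborel :: real measure))"
  proof (cases "i = n")
    case False
    with assms have "i \<in> {1..<n}" by auto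
    then show ?thesis using False by simp
  qed simp
  then have "(\<lambda>z. (z(n := 1)) i / ray_mean n z) \<in> borel_measurable (PiM {1..<n} (\<lambda>_. lborel))"
    by (rule borel_measurable_divide[OF _ ray_mean_measurable])
  then show ?thesis using assms unfolding ray_measure_def ray_point_def
    by (auto intro!: measurable_restrict_space1)
qed

text \<open>The set where the functions differ is open, and a nonempty open set is not null.\<close>

lemma eq_of_AE_eq_continuous:
  fixes \<phi> \<psi> :: "real \<Rightarrow> real"
  assumes cont: "continuous_on {0<..} \<phi>" "continuous_on {0<..} \<psi>"
    and ae: "AE s in lborel. s > 0 \<longrightarrow> \<phi> s = \<psi> s" and "s > 0"
  shows "\<phi> s = \<psi> s"
proof (rule ccontr)
  assume "\<phi> s \<noteq> \<psi> s"
  define U where "U = {s \<in> {0<..}. \<phi> s - \<psi> s \<in> - {0}}"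
  have "open U"
    unfolding U_def vimage_def[symmetric] Int_def[symmetric]
    using continuous_open_preimage[of "{0<..}" "\<lambda>s. \<phi> s - \<psi> s" "- {0}"] cont
    by (auto intro!: continuous_intros simp: vimage_def Int_def)
  moreover have "s \<in> U" using \<open>\<phi> s \<noteq> \<psi> s\<close> \<open>s > 0\<close> by (simp add: U_def)
  ultimately obtain e where e: "e > 0" "ball s e \<subseteq> U" by (auto simp: open_contains_ball)
  have "U \<in> null_sets lborel"
    using ae \<open>open U\<close> by (subst AE_iff_null_sets) (auto simp: U_def elim: eventually_mono)
  then have "emeasure lborel U = 0" by auto
  moreover have "emeasure lborel (ball s e) \<le> emeasure lborel U"
    using e \<open>open U\<close> by (intro emeasure_mono) auto
  moreover have "emeasure lborel (ball s e) > 0"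
    using e by (simp add: ball_eq_greaterThanLessThan)
  ultimately show False by simp
qed

section \<open>Normalization of gamma densities\<close>

lemma nn_integral_gamma_kernel:
  assumes "A > -1" "\<beta> > 0"
  shows "(\<integral>\<^sup>+x. ennreal (indicator {0<..} x * (x powr A * exp (- \<beta> * x))) \<partial>lborel)
    = ennreal (Gamma (A + 1) * (1 / \<beta>) powr (A + 1))"
proof -
  let ?g = "\<lambda>t::real. ennreal (indicator {0..} t * t powr A / exp t)"
  have Gpos: "Gamma (A + 1) > 0" using assms by (intro Gamma_real_pos) auto
  have "ennreal (Gamma (A + 1)) = (\<integral>\<^sup>+t. ?g t \<partial>lborel)"
    using Gamma_conv_nn_integral_real[of "A + 1"] assms by simp
  also have "\<dots> = \<bar>\<beta>\<bar> * (\<integral>\<^sup>+x. ?g (0 + \<beta> * x) \<partial>lborel)"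
    using assms by (intro nn_integral_real_affine) auto
  also have "(\<integral>\<^sup>+x. ?g (0 + \<beta> * x) \<partial>lborel)
    = (\<integral>\<^sup>+x. ennreal (\<beta> powr A) * ennreal (indicator {0<..} x * (x powr A * exp (- \<beta> * x))) \<partial>lborel)"
  proof (rule nn_integral_cong)
    fix x :: real
    show "?g (0 + \<beta> * x) = ennreal (\<beta> powr A) * ennreal (indicator {0<..} x * (x powr A * exp (- \<beta> * x)))"
    proof (cases "x > 0")
      case True
      then show ?thesis using assms
        by (simp add: ennreal_mult[symmetric] powr_mult exp_minus field_simps)
    next
      case False
      then have "\<beta> * x < 0 \<or> x = 0" using assms by (auto simp: mult_less_0_iff)
      then show ?thesis using False by auto
    qed
  qed
  also have "\<dots> = ennreal (\<beta> powr A) * (\<integral>\<^sup>+x. ennreal (indicator {0<..} x * (x powr A * exp (- \<beta> * x))) \<partial>lborel)"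
    by (intro nn_integral_cmult) measurable
  also have "ennreal \<bar>\<beta>\<bar> * (ennreal (\<beta> powr A) * J) = ennreal (\<beta> powr (A + 1)) * J" for J
    using assms by (simp add: mult.assoc[symmetric] ennreal_mult[symmetric] powr_add)
       (simp only: mult.commute)
  finally have eq: "ennreal (Gamma (A + 1)) = ennreal (\<beta> powr (A + 1)) *
      (\<integral>\<^sup>+x. ennreal (indicator {0<..} x * (x powr A * exp (- \<beta> * x))) \<partial>lborel)" .
  have "ennreal (Gamma (A + 1) * (1 / \<beta>) powr (A + 1))
      = ennreal ((1 / \<beta>) powr (A + 1)) * ennreal (Gamma (A + 1))"
    using Gpos by (simp add: ennreal_mult[symmetric] mult.commute)
  also have "\<dots> = (ennreal ((1 / \<beta>) powr (A + 1)) * ennreal (\<beta> powr (A + 1))) *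
      (\<integral>\<^sup>+x. ennreal (indicator {0<..} x * (x powr A * exp (- \<beta> * x))) \<partial>lborel)"
    unfolding eq by (simp only: mult.assoc)
  also have "ennreal ((1 / \<beta>) powr (A + 1)) * ennreal (\<beta> powr (A + 1)) = 1"
    using assms by (simp add: ennreal_mult[symmetric] powr_divide)
  finally show ?thesis by simp
qed

text \<open>The tool for excluding non-integrable parameters: a function of total mass \<open>1\<close> cannot dominate
  \<open>c / x\<close> on intervals of large logarithmic length.\<close>

lemma ln_bound_of_nn_integral:
  fixes f :: "real \<Rightarrow> real"
  assumes uv: "0 < u" "u \<le> v" and "c \<ge> 0"
    and le: "\<And>x. x \<in> {u..v} \<Longrightarrow> c / x \<le> f x"
    and total: "(\<integral>\<^sup>+x. ennreal (f x) \<partial>lborel) \<le> 1"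
  shows "c * (ln v - ln u) \<le> 1"
proof -
  have int: "(\<integral>\<^sup>+x. ennreal (c / x) * indicator {u..v} x \<partial>lborel) = ennreal (c * ln v - c * ln u)"
  proof (rule nn_integral_FTC_Icc)
    fix x assume "x \<in> {u..v}"
    then have "x > 0" using uv by auto
    then show "((\<lambda>x. c * ln x) has_real_derivative c / x) (at x)"
      by (auto intro!: derivative_eq_intros)
    show "0 \<le> c / x" using \<open>x > 0\<close> \<open>c \<ge> 0\<close> by simp
  next
    show "(\<lambda>x. c / x) \<in> borel_measurable borel" by measurable
  qed (rule uv)
  have "(\<integral>\<^sup>+x. ennreal (c / x) * indicator {u..v} x \<partial>lborel) \<le> (\<integral>\<^sup>+x. ennreal (f x) \<partial>lborel)"
    using le by (intro nn_integral_mono) (auto simp: indicator_def intro!: ennreal_leI)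
  from order_trans[OF this total] have "ennreal (c * ln v - c * ln u) \<le> 1" unfolding int .
  then show ?thesis by (simp add: right_diff_distrib)
qed

text \<open>If \<open>A \<le> -1\<close> the density dominates a multiple of \<open>1 / x\<close> near \<open>0\<close>; if \<open>A > -1\<close> and \<open>\<beta> \<le> 0\<close> it
  does so near infinity. Either contradicts total mass \<open>1\<close>, which then also fixes \<open>C\<close>.\<close>

lemma gamma_distribution_of_power_exponential:
  assumes f: "\<And>x. x \<le> 0 \<Longrightarrow> f x = 0" "\<And>x. x > 0 \<Longrightarrow> f x = C * x powr A * exp (- \<beta> * x)"
    and C: "C > 0" and total: "(\<integral>\<^sup>+x. ennreal (f x) \<partial>lborel) = 1"
  shows "gamma_distribution (density lborel (\<lambda>x. ennreal (f x)))"
proof -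
  have A: "A > -1"
  proof (rule ccontr)
    assume "\<not> A > -1"
    define c where "c = C * exp (- \<bar>\<beta>\<bar>)"
    have c: "c > 0" using C by (simp add: c_def)
    \<comment> \<open>The interval from \<open>exp (- 2 / c)\<close> to \<open>1\<close> has logarithmic length \<open>2 / c\<close>, twice what is possible.\<close>
    have "c * (ln 1 - ln (exp (- 2 / c))) \<le> 1"
    proof (rule ln_bound_of_nn_integral[where f=f])
      fix x assume x: "x \<in> {exp (- 2 / c)..1}"
      have "x > 0" using less_le_trans[OF exp_gt_zero, of "- 2 / c" x] x by simp
      have "x powr (-1) \<le> x powr A"
        using \<open>\<not> A > -1\<close> \<open>x > 0\<close> x by (intro powr_mono') auto
      moreover have "\<beta> * x \<le> \<bar>\<beta>\<bar>"
      proof -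
        have "\<beta> * x \<le> \<bar>\<beta>\<bar> * x" using \<open>x > 0\<close> by (intro mult_right_mono) auto
        also have "\<dots> \<le> \<bar>\<beta>\<bar>" using x by (simp add: mult_left_le)
        finally show ?thesis .
      qed
      ultimately have "(C * x powr (-1)) * exp (- \<bar>\<beta>\<bar>) \<le> (C * x powr A) * exp (- \<beta> * x)"
        using C by (intro mult_mono mult_left_mono) auto
      then show "c / x \<le> f x"
        using f(2)[OF \<open>x > 0\<close>] \<open>x > 0\<close> by (simp add: c_def powr_minus divide_inverse mult_ac)
    next
      show "0 < exp (- 2 / c)" "exp (- 2 / c) \<le> 1" "0 \<le> c" using c by auto
    qed (simp add: total)
    then show False using c by simp
  qed
  have \<beta>: "\<beta> > 0"
  proof (rule ccontr)
    assume "\<not> \<beta> > 0"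
    have "C * (ln (exp (2 / C)) - ln 1) \<le> 1"
    proof (rule ln_bound_of_nn_integral[where f=f])
      fix x assume x: "x \<in> {1..exp (2 / C)}"
      have "x powr (-1) \<le> x powr A" using A x by (intro powr_mono) auto
      moreover have "1 \<le> exp (- \<beta> * x)" using \<open>\<not> \<beta> > 0\<close> x by (simp add: mult_nonpos_nonneg)
      ultimately have "(C * x powr (-1)) * 1 \<le> (C * x powr A) * exp (- \<beta> * x)"
        using C by (intro mult_mono mult_left_mono) auto
      then show "C / x \<le> f x"
        using f(2)[of x] x by (simp add: powr_minus divide_inverse mult_ac)
    next
      show "(0::real) < 1" "1 \<le> exp (2 / C)" "0 \<le> C" using C by auto
    qed (simp add: total)
    then show False using C by simp
  qed
  let ?N = "Gamma (A + 1) * (1 / \<beta>) powr (A + 1)"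
  have "1 = (\<integral>\<^sup>+x. ennreal C * ennreal (indicator {0<..} x * (x powr A * exp (- \<beta> * x))) \<partial>lborel)"
    unfolding total[symmetric]
  proof (rule nn_integral_cong)
    fix x show "ennreal (f x) = ennreal C * ennreal (indicator {0<..} x * (x powr A * exp (- \<beta> * x)))"
      using f C by (cases "x > 0") (auto simp: ennreal_mult[symmetric] mult.assoc)
  qed
  also have "\<dots> = ennreal C * ennreal ?N"
    unfolding nn_integral_gamma_kernel[OF A \<beta>, symmetric] by (intro nn_integral_cmult) measurable
  also have "\<dots> = ennreal (C * ?N)" using C by (simp add: ennreal_mult')
  finally have "ennreal (C * ?N) = ennreal 1" by simp
  moreover have "?N > 0" using A \<beta> by (intro mult_pos_pos Gamma_real_pos) auto
  ultimately have "C * ?N = 1" using C by (simp add: ennreal_eq_1)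
  then have "C = 1 / ?N" using \<open>?N > 0\<close> by (metis less_irrefl nonzero_eq_divide_eq)
  then have "f x = gamma_density (A + 1) (1 / \<beta>) x" for x
    using f by (cases "x > 0") (simp_all add: gamma_density_def mult.commute)
  then show ?thesis
    unfolding gamma_distribution_def using A \<beta>
    by (intro exI[of _ "A + 1"] conjI exI[of _ "1 / \<beta>"]) auto
qed

section \<open>The joint law of the mean and the ratio\<close>

abbreviation (input) coords :: "nat \<Rightarrow> (nat \<Rightarrow> real) \<Rightarrow> real" where
  "coords \<equiv> \<lambda>i x. x i"

text \<open>The density is assumed to vanish on the nonpositive half line, so that integrals over the sample
  space are integrals over the positive orthant.\<close>

locale positive_sample = prob_space M for M :: "'a measure" +
  fixes X :: "nat \<Rightarrow> 'a \<Rightarrow> real" and f :: "real \<Rightarrow> real" and n :: nat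
    and p :: real and a :: "nat \<Rightarrow> real"
  assumes n: "n \<ge> 2"
    and indep: "indep_vars (\<lambda>_. borel) X {1..n}"
    and law: "\<And>i. i \<in> {1..n} \<Longrightarrow> distr M borel (X i) = density lborel (\<lambda>x. ennreal (f x))"
    and f_meas [measurable]: "f \<in> borel_measurable borel"
    and f_nonneg: "\<And>x. f x \<ge> 0"
    and f_zero: "\<And>x. x \<le> 0 \<Longrightarrow> f x = 0"
    and p: "p > 0"
    and a_nonneg: "\<And>i. i \<in> {1..n} \<Longrightarrow> a i \<ge> 0"
    and a_ends: "a 1 > 0" "a n > 0"
begin

lemma X_meas: "i \<in> {1..n} \<Longrightarrow> X i \<in> borel_measurable M"
  using indep unfolding indep_vars_def by auto

lemma mean_meas: "sample_mean n X \<in> borel_measurable M"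
  by (intro sample_mean_measurable X_meas)

lemma ratio_meas: "dispersion_ratio n a p X \<in> borel_measurable M"
  by (intro dispersion_ratio_measurable X_meas)

lemma total_mass: "(\<integral>\<^sup>+x. ennreal (f x) \<partial>lborel) = 1"
proof -
  have "prob_space (density lborel (\<lambda>x. ennreal (f x)))"
    using prob_space_distr[OF X_meas[of 1]] law[of 1] n by auto
  from prob_space.emeasure_space_1[OF this] show ?thesis by (simp add: emeasure_density)
qed

definition ray_ratio :: "(nat \<Rightarrow> real) \<Rightarrow> real" where
  "ray_ratio z = dispersion_ratio n a p coords (ray_point n z)"

lemma ray_mean_one:
  assumes "z \<in> space (ray_measure n)"
  shows "sample_mean n coords (ray_point n z) = 1"
  using ray_point_sum[OF _ assms] n by (simp add: sample_mean_def)

lemma ray_ratio_measurable: "ray_ratio \<in> borel_measurable (ray_measure n)"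
proof -
  have "dispersion_ratio n a p (\<lambda>i z. ray_point n z i) \<in> borel_measurable (ray_measure n)"
    by (intro dispersion_ratio_measurable ray_point_measurable)
  moreover have "ray_ratio = dispersion_ratio n a p (\<lambda>i z. ray_point n z i)"
    unfolding ray_ratio_def by (intro ext dispersion_ratio_cong) simp
  ultimately show ?thesis by simp
qed

text \<open>The sample has the product density; on the ray of \<open>z\<close> the point with mean \<open>s\<close> is
  \<open>s * ray_point n z\<close>, and the ratio does not depend on \<open>s\<close>.\<close>

lemma joint_law:
  assumes A: "A \<in> sets borel" and B: "B \<in> sets borel"
  shows "emeasure M {\<omega> \<in> space M. sample_mean n X \<omega> \<in> A \<and> dispersion_ratio n a p X \<omega> \<in> B}
    = (\<integral>\<^sup>+s. indicator A s * (ennreal (s ^ (n - 1)) * indicator {0<..} s *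
        (\<integral>\<^sup>+z. ennreal (\<Prod>i=1..n. f (s * ray_point n z i)) * indicator B (ray_ratio z) \<partial>ray_measure n))
        \<partial>lborel)"
proof -
  note [measurable] = A B mean_meas ratio_meas X_meas
  let ?L = "PiM {1..n} (\<lambda>_. lborel :: real measure)"
  have n1: "n \<ge> 1" using n by simp
  define V where "V \<omega> = (\<lambda>i\<in>{1..n}. X i \<omega>)" for \<omega>
  define Q where "Q x = (indicator A (sample_mean n coords x) * indicator B (dispersion_ratio n a p coords x) :: ennreal)" for x
  define D where "D x = (\<Prod>i=1..n. ennreal (f (x i)))" for x
  have coords_m: "coords i \<in> borel_measurable ?L" if "i \<in> {1..n}" for i
    using that by measurable
  have [measurable]: "sample_mean n coords \<in> borel_measurable ?L"
    "dispersion_ratio n a p coords \<in> borel_measurable ?L"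
    using coords_m by (auto intro: sample_mean_measurable dispersion_ratio_measurable)
  have Qm[measurable]: "Q \<in> borel_measurable ?L" unfolding Q_def by measurable
  have Dm[measurable]: "D \<in> borel_measurable ?L" unfolding D_def by measurable
  have sets_eq: "sets (PiM {1..n} (\<lambda>_. borel :: real measure)) = sets ?L"
    by (intro sets_PiM_cong) auto
  have Vm: "V \<in> measurable M (PiM {1..n} (\<lambda>_. borel))"
    unfolding V_def by (intro measurable_restrict X_meas)
  have sf: "sigma_finite_measure (density lborel (\<lambda>x. ennreal (f x)))"
  proof -
    interpret P: prob_space "density lborel (\<lambda>x. ennreal (f x))"
      using prob_space_distr[OF X_meas[of 1]] law[of 1] n by auto
    show ?thesis ..
  qed
  have distr: "distr M (PiM {1..n} (\<lambda>_. borel)) V = density ?L D"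
  proof -
    have "distr M (PiM {1..n} (\<lambda>_. borel)) V = PiM {1..n} (\<lambda>i. distr M borel (X i))"
      unfolding V_def using indep n
      by (subst (asm) indep_vars_iff_distr_eq_PiM') (auto intro: X_meas)
    also have "\<dots> = PiM {1..n} (\<lambda>_. density lborel (\<lambda>x. ennreal (f x)))"
      using law by (intro PiM_cong) auto
    also have "\<dots> = density ?L D"
      unfolding D_def by (intro PiM_density_lborel sf) auto
    finally show ?thesis .
  qed
  have mean_V: "sample_mean n coords (V \<omega>) = sample_mean n X \<omega>"
    and ratio_V: "dispersion_ratio n a p coords (V \<omega>) = dispersion_ratio n a p X \<omega>" for \<omega>
    unfolding V_def by (intro sample_mean_cong dispersion_ratio_cong; simp)+
  have "emeasure M {\<omega> \<in> space M. sample_mean n X \<omega> \<in> A \<and> dispersion_ratio n a p X \<omega> \<in> B}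
      = (\<integral>\<^sup>+\<omega>. indicator {\<omega> \<in> space M. sample_mean n X \<omega> \<in> A \<and> dispersion_ratio n a p X \<omega> \<in> B} \<omega> \<partial>M)"
    by (intro nn_integral_indicator[symmetric]) measurable
  also have "\<dots> = (\<integral>\<^sup>+\<omega>. Q (V \<omega>) \<partial>M)"
    unfolding Q_def mean_V ratio_V by (intro nn_integral_cong) (auto simp: indicator_def)
  also have "\<dots> = (\<integral>\<^sup>+x. Q x \<partial>distr M (PiM {1..n} (\<lambda>_. borel)) V)"
    using Qm by (intro nn_integral_distr[symmetric] Vm) (simp cong: measurable_cong_sets add: sets_eq)
  also have "\<dots> = (\<integral>\<^sup>+x. D x * Q x \<partial>?L)"
    unfolding distr by (intro nn_integral_density) measurable
  also have "\<dots> = (\<integral>\<^sup>+x. (D x * Q x) * indicator {x. \<forall>i\<in>{1..n}. x i > 0} x \<partial>?L)"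
  proof (rule nn_integral_cong)
    fix x :: "nat \<Rightarrow> real"
    show "D x * Q x = (D x * Q x) * indicator {x. \<forall>i\<in>{1..n}. x i > 0} x"
    proof (cases "\<forall>i\<in>{1..n}. x i > 0")
      case False
      then obtain i where "i \<in> {1..n}" "x i \<le> 0" by (auto simp: not_less)
      then have "D x = 0" unfolding D_def using f_zero by (intro prod_zero bexI[of _ i]) auto
      then show ?thesis by simp
    qed simp
  qed
  also have "\<dots> = (\<integral>\<^sup>+s. ennreal (s ^ (n - 1)) * indicator {0<..} s *
      (\<integral>\<^sup>+z. D (\<lambda>i\<in>{1..n}. s * ray_point n z i) * Q (\<lambda>i\<in>{1..n}. s * ray_point n z i) \<partial>ray_measure n) \<partial>lborel)"
    by (rule nn_integral_polar[OF n1]) measurable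
  also have "\<dots> = (\<integral>\<^sup>+s. indicator A s * (ennreal (s ^ (n - 1)) * indicator {0<..} s *
        (\<integral>\<^sup>+z. ennreal (\<Prod>i=1..n. f (s * ray_point n z i)) * indicator B (ray_ratio z) \<partial>ray_measure n))
        \<partial>lborel)"
  proof (rule nn_integral_cong)
    fix s :: real
    show "ennreal (s ^ (n - 1)) * indicator {0<..} s *
      (\<integral>\<^sup>+z. D (\<lambda>i\<in>{1..n}. s * ray_point n z i) * Q (\<lambda>i\<in>{1..n}. s * ray_point n z i) \<partial>ray_measure n)
      = indicator A s * (ennreal (s ^ (n - 1)) * indicator {0<..} s *
        (\<integral>\<^sup>+z. ennreal (\<Prod>i=1..n. f (s * ray_point n z i)) * indicator B (ray_ratio z) \<partial>ray_measure n))"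
    proof (cases "s > 0")
      case True
      have "(\<integral>\<^sup>+z. D (\<lambda>i\<in>{1..n}. s * ray_point n z i) * Q (\<lambda>i\<in>{1..n}. s * ray_point n z i) \<partial>ray_measure n)
        = (\<integral>\<^sup>+z. indicator A s * (ennreal (\<Prod>i=1..n. f (s * ray_point n z i)) * indicator B (ray_ratio z)) \<partial>ray_measure n)"
      proof (rule nn_integral_cong)
        fix z assume z: "z \<in> space (ray_measure n)"
        let ?x = "\<lambda>i\<in>{1..n}. s * ray_point n z i"
        have "sample_mean n coords ?x = s * sample_mean n coords (ray_point n z)"
          unfolding sample_mean_def by (simp add: sum_distrib_left)
        then have mean: "sample_mean n coords ?x = s" using ray_mean_one[OF z] by simp
        have "dispersion_ratio n a p coords ?x = dispersion_ratio n a p (\<lambda>i x. s * coords i x) (ray_point n z)"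
          by (intro dispersion_ratio_cong) simp
        then have ratio: "dispersion_ratio n a p coords ?x = ray_ratio z"
          unfolding ray_ratio_def using dispersion_ratio_scale[OF True p a_nonneg] by simp
        have "D ?x = (\<Prod>i=1..n. ennreal (f (s * ray_point n z i)))"
          unfolding D_def by (intro prod.cong) auto
        also have "\<dots> = ennreal (\<Prod>i=1..n. f (s * ray_point n z i))"
          by (intro prod_ennreal f_nonneg)
        finally show "D ?x * Q ?x = indicator A s * (ennreal (\<Prod>i=1..n. f (s * ray_point n z i)) * indicator B (ray_ratio z))"
          unfolding Q_def mean ratio by (simp add: mult_ac)
      qed
      also have "\<dots> = indicator A s * (\<integral>\<^sup>+z. ennreal (\<Prod>i=1..n. f (s * ray_point n z i)) * indicator B (ray_ratio z) \<partial>ray_measure n)"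
      proof (rule nn_integral_cmult)
        note [measurable] = ray_ratio_measurable
        have "(\<lambda>z. \<Prod>i=1..n. f (s * ray_point n z i)) \<in> borel_measurable (ray_measure n)"
        proof (rule borel_measurable_prod)
          fix i assume i: "i \<in> {1..n}"
          note [measurable] = ray_point_measurable[OF i]
          show "(\<lambda>z. f (s * ray_point n z i)) \<in> borel_measurable (ray_measure n)" by measurable
        qed
        then show "(\<lambda>z. ennreal (\<Prod>i=1..n. f (s * ray_point n z i)) * indicator B (ray_ratio z))
          \<in> borel_measurable (ray_measure n)" by measurable
      qed
      finally show ?thesis by (simp add: mult_ac)
    qed simp
  qed
  finally show ?thesis .
qed

section \<open>Gamma samples have independent mean and ratio\<close>

text \<open>The exponential factors of the joint density multiply to \<open>exp (- n * s / b)\<close>, because the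
  coordinates of a ray point add up to \<open>n\<close>; the power factors split anyway. Hence the joint law is a
  product \<open>u A * v B\<close>. The factors are not normalized separately, only \<open>u UNIV * v UNIV = 1\<close>.\<close>

lemma independent_if_gamma:
  assumes f: "f = gamma_density \<alpha> b"
  shows "indep_var borel (sample_mean n X) borel (dispersion_ratio n a p X)"
proof -
  note [measurable] = mean_meas ratio_meas
  define c where "c = 1 / (Gamma \<alpha> * b powr \<alpha>)"
  define h where "h s = ennreal (s ^ (n - 1)) * indicator {0<..} s *
      ennreal (c ^ n * (s powr (\<alpha> - 1)) ^ n * exp (- (real n * s / b)))" for s
  define u where "u A = (\<integral>\<^sup>+s. h s * indicator A s \<partial>lborel)" for A
  define v where "v B = (\<integral>\<^sup>+z. ennreal (\<Prod>i=1..n. ray_point n z i powr (\<alpha> - 1)) * indicator B (ray_ratio z)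
      \<partial>ray_measure n)" for B
  have c: "c \<ge> 0"
    using f_nonneg[of 1] unfolding f gamma_density_def c_def by (simp add: zero_le_mult_iff zero_le_divide_iff)
  have split: "emeasure M {\<omega> \<in> space M. sample_mean n X \<omega> \<in> A \<and> dispersion_ratio n a p X \<omega> \<in> B} = u A * v B"
    if AB[measurable]: "A \<in> sets borel" "B \<in> sets borel" for A B
  proof -
    have slice: "indicator A s * (ennreal (s ^ (n - 1)) * indicator {0<..} s *
        (\<integral>\<^sup>+z. ennreal (\<Prod>i=1..n. f (s * ray_point n z i)) * indicator B (ray_ratio z) \<partial>ray_measure n))
      = h s * indicator A s * v B" for s
    proof (cases "s > 0")
      case s: True
      have "(\<integral>\<^sup>+z. ennreal (\<Prod>i=1..n. f (s * ray_point n z i)) * indicator B (ray_ratio z) \<partial>ray_measure n)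
        = (\<integral>\<^sup>+z. ennreal (c ^ n * (s powr (\<alpha> - 1)) ^ n * exp (- (real n * s / b))) *
            (ennreal (\<Prod>i=1..n. ray_point n z i powr (\<alpha> - 1)) * indicator B (ray_ratio z)) \<partial>ray_measure n)"
      proof (rule nn_integral_cong)
        fix z assume z: "z \<in> space (ray_measure n)"
        have pos: "ray_point n z i > 0" if "i \<in> {1..n}" for i
          using ray_point_pos[OF _ z that] n by simp
        have "(\<Prod>i=1..n. f (s * ray_point n z i))
          = (\<Prod>i=1..n. c * s powr (\<alpha> - 1) * ray_point n z i powr (\<alpha> - 1) * exp (- (s / b) * ray_point n z i))"
          using s pos c by (intro prod.cong refl) (simp add: f gamma_density_def c_def powr_mult)
        also have "\<dots> = c ^ n * (s powr (\<alpha> - 1)) ^ n * (\<Prod>i=1..n. ray_point n z i powr (\<alpha> - 1)) *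
            exp (- (s / b) * (\<Sum>i=1..n. ray_point n z i))"
          by (simp add: prod.distrib power_mult_distrib exp_sum sum_distrib_left)
        also have "(\<Sum>i=1..n. ray_point n z i) = real n" using ray_point_sum[OF _ z] n by simp
        finally have "(\<Prod>i=1..n. f (s * ray_point n z i))
          = (c ^ n * (s powr (\<alpha> - 1)) ^ n * exp (- (real n * s / b))) * (\<Prod>i=1..n. ray_point n z i powr (\<alpha> - 1))"
          by (simp add: mult_ac)
        moreover have "(\<Prod>i=1..n. ray_point n z i powr (\<alpha> - 1)) \<ge> 0" by (intro prod_nonneg) auto
        ultimately show "ennreal (\<Prod>i=1..n. f (s * ray_point n z i)) * indicator B (ray_ratio z)
          = ennreal (c ^ n * (s powr (\<alpha> - 1)) ^ n * exp (- (real n * s / b))) *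
            (ennreal (\<Prod>i=1..n. ray_point n z i powr (\<alpha> - 1)) * indicator B (ray_ratio z))"
          using c by (simp add: ennreal_mult mult.assoc)
      qed
      also have "\<dots> = ennreal (c ^ n * (s powr (\<alpha> - 1)) ^ n * exp (- (real n * s / b))) * v B"
        unfolding v_def
      proof (rule nn_integral_cmult)
        note [measurable] = ray_ratio_measurable
        have "(\<lambda>z. \<Prod>i=1..n. ray_point n z i powr (\<alpha> - 1)) \<in> borel_measurable (ray_measure n)"
        proof (rule borel_measurable_prod)
          fix i assume i: "i \<in> {1..n}"
          note [measurable] = ray_point_measurable[OF i]
          show "(\<lambda>z. ray_point n z i powr (\<alpha> - 1)) \<in> borel_measurable (ray_measure n)" by measurable
        qed
        then show "(\<lambda>z. ennreal (\<Prod>i=1..n. ray_point n z i powr (\<alpha> - 1)) * indicator B (ray_ratio z))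
          \<in> borel_measurable (ray_measure n)" by measurable
      qed
      finally show ?thesis by (simp add: h_def mult_ac)
    qed (simp add: h_def)
    show ?thesis
      unfolding joint_law[OF AB] slice u_def
      by (intro nn_integral_multc) (simp add: h_def)
  qed
  have one: "u UNIV * v UNIV = 1"
    using split[of UNIV UNIV] emeasure_space_1 by simp
  interpret S: prob_space "distr M borel (sample_mean n X)" by (rule prob_space_distr) (rule mean_meas)
  interpret T: prob_space "distr M borel (dispersion_ratio n a p X)" by (rule prob_space_distr) (rule ratio_meas)
  have "distr M borel (sample_mean n X) \<Otimes>\<^sub>M distr M borel (dispersion_ratio n a p X)
      = distr M (borel \<Otimes>\<^sub>M borel) (\<lambda>x. (sample_mean n X x, dispersion_ratio n a p X x))"
  proof (rule pair_measure_eqI)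
    fix A B assume "A \<in> sets (distr M borel (sample_mean n X))" "B \<in> sets (distr M borel (dispersion_ratio n a p X))"
    then have AB[measurable]: "A \<in> sets borel" "B \<in> sets borel" by auto
    have "emeasure (distr M borel (sample_mean n X)) A = u A * v UNIV"
      using split[OF AB(1), of UNIV] by (simp add: emeasure_distr vimage_def Int_def conj_commute)
    moreover have "emeasure (distr M borel (dispersion_ratio n a p X)) B = u UNIV * v B"
      using split[OF _ AB(2), of UNIV] by (simp add: emeasure_distr vimage_def Int_def conj_commute)
    moreover have "emeasure (distr M (borel \<Otimes>\<^sub>M borel) (\<lambda>x. (sample_mean n X x, dispersion_ratio n a p X x))) (A \<times> B) = u A * v B"
      using split[OF AB] by (simp add: emeasure_distr vimage_def Int_def conj_commute)
    moreover have "(u A * v UNIV) * (u UNIV * v B) = (u UNIV * v UNIV) * (u A * v B)"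
      by (simp only: mult_ac)
    ultimately show "emeasure (distr M borel (sample_mean n X)) A * emeasure (distr M borel (dispersion_ratio n a p X)) B
      = emeasure (distr M (borel \<Otimes>\<^sub>M borel) (\<lambda>x. (sample_mean n X x, dispersion_ratio n a p X x))) (A \<times> B)"
      using one by simp
  qed (auto intro: S.sigma_finite_measure_axioms T.sigma_finite_measure_axioms)
  then show ?thesis
    unfolding indep_var_distribution_eq using mean_meas ratio_meas by blast
qed

end

section \<open>Independence forces a gamma density\<close>

context positive_sample
begin

lemma ray_ratio_lower:
  assumes "z \<in> space (ray_measure n)" "i \<in> {1..n}"
  shows "min (a 1) (a n) powr (1 / p) * \<bar>ray_point n z i - 1\<bar> \<le> ray_ratio z"
  using dispersion_ratio_lower[OF p a_nonneg a_ends ray_mean_one[OF assms(1)] assms(2)]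
  unfolding ray_ratio_def by simp

lemma ray_ratio_upper:
  assumes "z \<in> space (ray_measure n)" "\<delta> \<ge> 0" "\<And>i. i \<in> {1..n} \<Longrightarrow> \<bar>ray_point n z i - 1\<bar> \<le> \<delta>"
  shows "ray_ratio z \<le> (\<Sum>i=1..n. a i) powr (1 / p) * \<delta>"
  unfolding ray_ratio_def
  by (rule dispersion_ratio_upper[OF p a_nonneg ray_mean_one[OF assms(1)] _ assms(2)])
     (auto intro: assms(3))

lemma emeasure_ray_measure:
  assumes "D \<in> sets (ray_measure n)"
  shows "emeasure (ray_measure n) D
    = (\<integral>\<^sup>+z. ennreal (1 / \<bar>ray_mean n z\<bar> ^ n) * indicator D z \<partial>PiM {1..<n} (\<lambda>_. lborel))"
proof -
  let ?L = "PiM {1..<n} (\<lambda>_. lborel :: real measure)"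
  let ?N = "density ?L (\<lambda>z. ennreal (1 / \<bar>ray_mean n z\<bar> ^ n))"
  let ?P = "{z::nat \<Rightarrow> real. \<forall>i\<in>{1..<n}. z i > 0}"
  have "Measurable.pred ?L (\<lambda>z. \<forall>i\<in>{1..<n}. z i > 0)" by measurable
  then have P: "?P \<inter> space ?N \<in> sets ?N" by (simp add: pred_def Int_def conj_commute)
  have "D \<in> sets ?N" "D \<subseteq> ?P"
    using assms sets_restrict_space_iff[OF P, of D] unfolding ray_measure_def by auto
  then have "emeasure (ray_measure n) D = emeasure ?N D"
    unfolding ray_measure_def by (intro emeasure_restrict_space P)
  also have "\<dots> = (\<integral>\<^sup>+z. ennreal (1 / \<bar>ray_mean n z\<bar> ^ n) * indicator D z \<partial>?L)"
  proof (rule emeasure_density)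
    show "(\<lambda>z. ennreal (1 / \<bar>ray_mean n z\<bar> ^ n)) \<in> borel_measurable ?L" by measurable
    show "D \<in> sets ?L" using \<open>D \<in> sets ?N\<close> by (simp only: sets_density)
  qed
  finally show ?thesis .
qed

lemma ray_box_in_sets:
  assumes "\<And>i. i \<in> {1..<n} \<Longrightarrow> A i \<in> sets borel" "\<And>i. i \<in> {1..<n} \<Longrightarrow> A i \<subseteq> {0<..}"
  shows "Pi\<^sub>E {1..<n} A \<in> sets (ray_measure n)"
proof -
  have "Pi\<^sub>E {1..<n} A \<in> sets (PiM {1..<n} (\<lambda>_. lborel :: real measure))"
    using assms by (intro sets_PiM_I_finite) auto
  moreover have "Pi\<^sub>E {1..<n} A = {z. \<forall>i\<in>{1..<n}. z i > 0} \<inter> Pi\<^sub>E {1..<n} A"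
    using assms by (fastforce simp: PiE_iff)
  ultimately show ?thesis unfolding ray_measure_def sets_restrict_space by auto
qed

text \<open>Near the diagonal the last coordinate of a ray point, which is \<open>1 / ray_mean n z\<close>, is bounded
  away from \<open>0\<close> and infinity; so are the density of the ray measure and the coordinates \<open>z i\<close>.\<close>

lemma ray_measure_near_diagonal_finite:
  assumes D: "D \<in> sets (ray_measure n)"
    and near: "\<And>z i. z \<in> D \<Longrightarrow> i \<in> {1..n} \<Longrightarrow> ray_point n z i \<in> {1/2..3/2}"
  shows "emeasure (ray_measure n) D < \<infinity>"
proof -
  let ?L = "PiM {1..<n} (\<lambda>_. lborel :: real measure)"
  let ?B = "Pi\<^sub>E {1..<n} (\<lambda>_. {0..3::real})"
  have n1: "n \<ge> 1" using n by simp
  have "emeasure (ray_measure n) D \<le> (\<integral>\<^sup>+z. ennreal ((3/2) ^ n) * indicator ?B z \<partial>?L)"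
    unfolding emeasure_ray_measure[OF D]
  proof (rule nn_integral_mono)
    fix z assume "z \<in> space ?L"
    show "ennreal (1 / \<bar>ray_mean n z\<bar> ^ n) * indicator D z \<le> ennreal ((3/2) ^ n) * indicator ?B z"
    proof (cases "z \<in> D")
      case True
      then have zs: "z \<in> space (ray_measure n)" using sets.sets_into_space[OF D] by auto
      then have m: "ray_mean n z > 0" by (intro ray_mean_pos n1) (auto simp: space_ray_measure)
      have "ray_point n z n = 1 / ray_mean n z" using n1 by (simp add: ray_point_def)
      then have inv: "1 / ray_mean n z \<in> {1/2..3/2}" using near[OF True, of n] n1 by simp
      then have "ray_mean n z \<le> 2" using m by (simp add: field_simps)
      have "z i \<in> {0..3}" if i: "i \<in> {1..<n}" for i
      proof -
        have zi: "z i = ray_point n z i * ray_mean n z" using i m by (simp add: ray_point_def)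
        have "ray_point n z i \<le> 3/2" using near[OF True, of i] i by auto
        then have "ray_point n z i * ray_mean n z \<le> (3/2) * 2"
          using m \<open>ray_mean n z \<le> 2\<close> by (intro mult_mono) linarith+
        then have "z i \<le> 3" unfolding zi[symmetric] by simp
        moreover have "z i > 0" using zs i by (simp add: space_ray_measure)
        ultimately show ?thesis by simp
      qed
      then have "z \<in> ?B" using \<open>z \<in> space ?L\<close> by (auto simp: space_PiM PiE_iff)
      moreover have "(1 / ray_mean n z) ^ n \<le> (3/2) ^ n" using inv m by (intro power_mono) auto
      ultimately show ?thesis using m True by (simp add: power_one_over ennreal_leI)
    qed simp
  qed
  also have "\<dots> = ennreal ((3/2) ^ n) * emeasure ?L ?B"
    by (intro nn_integral_cmult_indicator sets_PiM_I_finite) auto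
  also have "emeasure ?L ?B = (\<Prod>i\<in>{1..<n}. emeasure lborel {0..3::real})"
    by (intro lborels.emeasure_PiM) auto
  also have "ennreal ((3/2) ^ n) * \<dots> < \<infinity>"
    by (simp add: ennreal_mult_less_top power_less_top_ennreal)
  finally show ?thesis .
qed

text \<open>A box of rays that lies close to the diagonal ray but does not contain it: all coordinates \<open>z i\<close>
  exceed the last coordinate \<open>1\<close>, so the mean does too. It witnesses that small sublevel sets of the
  ratio have positive measure off the diagonal.\<close>

lemma off_diagonal_box:
  assumes \<delta>: "\<delta> > 0" and z: "z \<in> Pi\<^sub>E {1..<n} (\<lambda>_. {1<..<1 + \<delta>})"
  shows "z \<in> space (ray_measure n)" "ray_mean n z \<in> {1<..1 + \<delta>}"
    "ray_point n z n \<noteq> 1" "\<And>i. i \<in> {1..n} \<Longrightarrow> \<bar>ray_point n z i - 1\<bar> \<le> \<delta>"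
proof -
  have zi: "1 < z i" "z i < 1 + \<delta>" if "i \<in> {1..<n}" for i
    using z that by (auto simp: PiE_iff)
  show "z \<in> space (ray_measure n)"
    using z zi by (force simp: space_ray_measure space_PiM PiE_iff)
  have "(\<Sum>i\<in>{1..<n}. 1) < (\<Sum>i\<in>{1..<n}. z i)"
    using n zi by (intro sum_strict_mono) auto
  moreover have "(\<Sum>i\<in>{1..<n}. z i) \<le> (\<Sum>i\<in>{1..<n}. 1 + \<delta>)"
    using zi by (intro sum_mono) (auto intro: less_imp_le)
  ultimately have "real n < 1 + (\<Sum>i\<in>{1..<n}. z i)" "1 + (\<Sum>i\<in>{1..<n}. z i) \<le> 1 + (real n - 1) * (1 + \<delta>)"
    using n by (simp_all add: of_nat_diff)
  moreover have "1 + (real n - 1) * (1 + \<delta>) \<le> real n * (1 + \<delta>)"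
    using \<delta> by (simp add: algebra_simps)
  ultimately show m: "ray_mean n z \<in> {1<..1 + \<delta>}"
    using n by (simp add: ray_mean_def field_simps)
  show "ray_point n z n \<noteq> 1" using m n by (simp add: ray_point_def)
  fix i assume i: "i \<in> {1..n}"
  define y where "y = (z(n := 1)) i"
  have y: "1 \<le> y" "y \<le> 1 + \<delta>"
    using zi[of i] i \<delta> by (cases "i = n"; simp add: y_def)+
  have "ray_point n z i - 1 = (y - ray_mean n z) / ray_mean n z"
    using m i by (simp add: ray_point_def y_def diff_divide_distrib)
  moreover have "\<bar>y - ray_mean n z\<bar> \<le> \<delta> * ray_mean n z"
  proof -
    have "\<bar>y - ray_mean n z\<bar> \<le> \<delta> * 1" using y m by auto
    also have "\<dots> \<le> \<delta> * ray_mean n z" using m \<delta> by (intro mult_left_mono) auto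
    finally show ?thesis .
  qed
  ultimately show "\<bar>ray_point n z i - 1\<bar> \<le> \<delta>" using m by (simp add: abs_divide divide_le_eq)
qed

lemma off_diagonal_box_positive:
  assumes \<delta>: "\<delta> > 0"
  shows "emeasure (ray_measure n) (Pi\<^sub>E {1..<n} (\<lambda>_. {1<..<1 + \<delta>})) > 0"
proof -
  let ?L = "PiM {1..<n} (\<lambda>_. lborel :: real measure)"
  let ?B = "Pi\<^sub>E {1..<n} (\<lambda>_. {1<..<1 + \<delta>})"
  have B: "?B \<in> sets (ray_measure n)" by (intro ray_box_in_sets) auto
  have "emeasure ?L ?B = (\<Prod>i\<in>{1..<n}. emeasure lborel {1<..<1 + \<delta>})"
    by (intro lborels.emeasure_PiM) auto
  also have "\<dots> = ennreal (\<delta> ^ (n - 1))" using \<delta> by (simp add: ennreal_power)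
  finally have "ennreal (1 / (1 + \<delta>) ^ n) * emeasure ?L ?B > 0"
    using \<delta> by (simp add: ennreal_zero_less_mult_iff)
  also have "ennreal (1 / (1 + \<delta>) ^ n) * emeasure ?L ?B
      = (\<integral>\<^sup>+z. ennreal (1 / (1 + \<delta>) ^ n) * indicator ?B z \<partial>?L)"
    by (intro nn_integral_cmult_indicator[symmetric] sets_PiM_I_finite) auto
  also have "\<dots> \<le> emeasure (ray_measure n) ?B"
    unfolding emeasure_ray_measure[OF B]
  proof (rule nn_integral_mono)
    fix z
    show "ennreal (1 / (1 + \<delta>) ^ n) * indicator ?B z \<le> ennreal (1 / \<bar>ray_mean n z\<bar> ^ n) * indicator ?B z"
    proof (cases "z \<in> ?B")
      case True
      have "1 / (1 + \<delta>) ^ n \<le> 1 / \<bar>ray_mean n z\<bar> ^ n"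
        using off_diagonal_box(2)[OF \<delta> True] by (intro divide_left_mono power_mono) auto
      then show ?thesis using True by (simp add: ennreal_leI)
    qed simp
  qed
  finally show ?thesis .
qed

text \<open>Restricting the ray measure to the sublevel sets of the ratio at levels \<open>t k\<close> decreasing to \<open>0\<close>
  gives contracting measures on the simplex. Independence factorizes their averages.\<close>

theorem gamma_if_independent:
  assumes cont: "continuous_on {0<..} f" and pos: "\<And>x. x > 0 \<Longrightarrow> f x > 0"
    and ind: "indep_var borel (sample_mean n X) borel (dispersion_ratio n a p X)"
  shows "gamma_distribution (density lborel (\<lambda>x. ennreal (f x)))"
proof -
  note [measurable] = mean_meas ratio_meas ray_ratio_measurable
  have n1: "n \<ge> 1" using n by simp
  define \<kappa> where "\<kappa> = min (a 1) (a n) powr (1 / p)"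
  have \<kappa>: "\<kappa> > 0" using a_ends by (simp add: \<kappa>_def)
  \<comment> \<open>Deviations on a sublevel set are at most the level divided by \<open>\<kappa>\<close>; the initial level \<open>\<kappa> / 2\<close> keeps
    all coordinates within \<open>1 / 2\<close> of \<open>1\<close>.\<close>
  define t where "t k = \<kappa> / 2 / real (Suc k)" for k
  have t_pos: "t k > 0" for k using \<kappa> by (simp add: t_def)
  have t_le: "t k \<le> \<kappa> / 2" for k using \<kappa> by (simp add: t_def divide_le_eq)
  define D where "D k = {z \<in> space (ray_measure n). ray_ratio z \<le> t k}" for k
  have D[measurable]: "D k \<in> sets (ray_measure n)" for k unfolding D_def by measurable
  define \<mu> where "\<mu> k = restrict_space (ray_measure n) (D k)" for k
  have space_\<mu>: "space (\<mu> k) = D k" for k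
    unfolding \<mu>_def space_restrict_space D_def by auto
  have close: "\<bar>ray_point n z i - 1\<bar> \<le> t k / \<kappa>" if "z \<in> D k" "i \<in> {1..n}" for z i k
  proof -
    have "\<kappa> * \<bar>ray_point n z i - 1\<bar> \<le> ray_ratio z"
      unfolding \<kappa>_def using that by (intro ray_ratio_lower) (auto simp: D_def)
    also have "\<dots> \<le> t k" using that by (simp add: D_def)
    finally show ?thesis using \<kappa> by (simp add: le_divide_eq mult.commute)
  qed
  have near: "ray_point n z i \<in> {1/2..3/2}" if "z \<in> D k" "i \<in> {1..n}" for z i k
  proof -
    have "t k / \<kappa> \<le> 1 / 2" using t_le[of k] \<kappa> by (simp add: field_simps)
    with close[OF that] have "\<bar>ray_point n z i - 1\<bar> \<le> 1 / 2" by linarith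
    then show ?thesis unfolding abs_le_iff atLeastAtMost_iff by linarith
  qed
  interpret shrinking_simplex \<mu> "\<lambda>i z. ray_point n z i" "{1..n}"
  proof (rule shrinking_simplex.intro)
    show "finite {1..n}" by simp
    fix k
    have "emeasure (\<mu> k) (space (\<mu> k)) = emeasure (ray_measure n) (D k)"
      unfolding space_\<mu> unfolding \<mu>_def by (intro emeasure_restrict_space) auto
    also have "\<dots> < \<infinity>"
      by (rule ray_measure_near_diagonal_finite[OF D]) (rule near)
    finally have "emeasure (\<mu> k) (space (\<mu> k)) \<noteq> \<infinity>" by simp
    then show "finite_measure (\<mu> k)" by (rule finite_measureI)
    fix i assume i: "i \<in> {1..n}"
    show "(\<lambda>z. ray_point n z i) \<in> borel_measurable (\<mu> k)"
      unfolding \<mu>_def by (intro measurable_restrict_space1 ray_point_measurable i)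
    show "ray_point n z i \<in> {1/2..3/2}" if "z \<in> space (\<mu> k)" for z
      using near i that unfolding space_\<mu> by blast
  next
    fix k z assume "z \<in> space (\<mu> k)"
    then have "z \<in> space (ray_measure n)" unfolding space_\<mu> D_def by simp
    from ray_point_sum[OF n1 this] show "(\<Sum>i\<in>{1..n}. ray_point n z i) = real (card {1..n})" by simp
  next
    fix \<delta> :: real assume \<delta>: "\<delta> > 0"
    have "(\<lambda>k. (1 / 2) * (1 / real (Suc k))) \<longlonglongrightarrow> (1 / 2) * 0"
      by (intro tendsto_intros LIMSEQ_Suc[OF lim_const_over_n[of 1, unfolded of_real_1]])
    then have "(\<lambda>k. t k / \<kappa>) \<longlonglongrightarrow> 0" using \<kappa> by (simp add: t_def)
    then have "eventually (\<lambda>k. t k / \<kappa> < \<delta>) sequentially" using \<delta> by (rule order_tendstoD)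
    then show "eventually (\<lambda>k. \<forall>z\<in>space (\<mu> k). \<forall>i\<in>{1..n}. \<bar>ray_point n z i - 1\<bar> < \<delta>) sequentially"
      unfolding space_\<mu> by eventually_elim (use close in \<open>blast intro: le_less_trans\<close>)
  next
    fix k
    define S where "S = (\<Sum>i=1..n. a i) powr (1 / p)"
    have "(\<Sum>i=1..n. a i) > 0" using a_nonneg a_ends n1 by (intro sum_pos2[where i=1]) auto
    then have S: "S > 0" by (simp add: S_def)
    let ?B = "Pi\<^sub>E {1..<n} (\<lambda>_. {1<..<1 + t k / S})"
    let ?E = "{z \<in> space (\<mu> k). \<exists>i\<in>{1..n}. ray_point n z i \<noteq> 1}"
    have \<delta>: "t k / S > 0" using S t_pos by simp
    have "?B \<subseteq> ?E"
    proof
      fix z assume z: "z \<in> ?B"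
      note box = off_diagonal_box[OF \<delta> z]
      have "ray_ratio z \<le> S * (t k / S)"
        unfolding S_def using box \<delta> by (intro ray_ratio_upper) (auto simp: S_def)
      then show "z \<in> ?E" using box(1,3) S n1 unfolding space_\<mu> by (auto simp: D_def)
    qed
    have rp: "(\<lambda>z. ray_point n z i) \<in> borel_measurable (ray_measure n)" if "i \<in> {1..n}" for i
      using that by (rule ray_point_measurable)
    have E: "?E \<in> sets (ray_measure n)"
      unfolding space_\<mu> D_def using rp by measurable
    have "?B \<in> sets (ray_measure n)" by (intro ray_box_in_sets) auto
    have "0 < emeasure (ray_measure n) ?B" by (rule off_diagonal_box_positive[OF \<delta>])
    also have "\<dots> \<le> emeasure (ray_measure n) ?E" using \<open>?B \<subseteq> ?E\<close> E by (intro emeasure_mono)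
    also have "\<dots> = emeasure (\<mu> k) ?E"
      unfolding \<mu>_def using D[of k] 
      by (intro emeasure_restrict_space[symmetric]) (auto simp: space_restrict_space)
    finally show "emeasure (\<mu> k) ?E > 0" .
  qed
  \<comment> \<open>\<open>H k\<close> is the density of the mean on the event that the ratio is at most \<open>t k\<close>, and \<open>q k\<close> is
    the probability of this event.\<close>
  define q where "q k = prob {\<omega> \<in> space M. dispersion_ratio n a p X \<omega> \<in> {..t k}}" for k
  define H where "H k s = indicator {0<..} s *\<^sub>R (s ^ (n - 1) * avg f k s)" for k s
  have avg_nonneg: "avg f k s \<ge> 0" for k s
    unfolding avg_def by (intro integral_nonneg_AE AE_I2 prod_nonneg) (simp add: f_nonneg)
  have avg_pos: "avg f k s > 0" if s: "s > 0" for k s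
  proof -
    interpret finite_measure "\<mu> k" by (rule fin)
    have "(\<integral>z. 0 \<partial>\<mu> k) < avg f k s"
      unfolding avg_def
    proof (rule integral_less_AE_space)
      show "AE z in \<mu> k. 0 < (\<Prod>i\<in>{1..n}. f (s * ray_point n z i))"
        using w_pos s pos by (intro AE_I2 prod_pos) auto
      show "emeasure (\<mu> k) (space (\<mu> k)) \<noteq> 0"
        using volume_pos[of k] by (simp add: emeasure_eq_measure)
    qed (rule integrable_zero, rule prod_integrable[OF f_meas cont s])
    then show ?thesis by simp
  qed
  have H_nonneg: "H k s \<ge> 0" for k s
    unfolding H_def using avg_nonneg by (auto simp: indicator_def)
  have H_meas[measurable]: "H k \<in> borel_measurable borel" for k
    unfolding H_def
    by (intro borel_measurable_continuous_on_indicator continuous_intros avg_continuous cont f_meas) auto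
  have slice: "(\<integral>\<^sup>+z. ennreal (\<Prod>i=1..n. f (s * ray_point n z i)) * indicator {..t k} (ray_ratio z) \<partial>ray_measure n)
      = ennreal (avg f k s)" if s: "s > 0" for k s
  proof -
    have "(\<integral>\<^sup>+z. ennreal (\<Prod>i=1..n. f (s * ray_point n z i)) * indicator {..t k} (ray_ratio z) \<partial>ray_measure n)
      = (\<integral>\<^sup>+z. ennreal (\<Prod>i=1..n. f (s * ray_point n z i)) * indicator (D k) z \<partial>ray_measure n)"
      by (intro nn_integral_cong) (auto simp: D_def indicator_def)
    also have "\<dots> = (\<integral>\<^sup>+z. ennreal (\<Prod>i=1..n. f (s * ray_point n z i)) \<partial>\<mu> k)"
      unfolding \<mu>_def by (intro nn_integral_restrict_space[symmetric]) auto
    also have "\<dots> = ennreal (avg f k s)"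
      unfolding avg_def
      by (intro nn_integral_eq_integral prod_integrable cont s f_meas AE_I2 prod_nonneg f_nonneg)
    finally show ?thesis .
  qed
  have law_H: "(\<integral>\<^sup>+s. ennreal (H k s) * indicator A s \<partial>lborel)
      = ennreal (prob {\<omega> \<in> space M. sample_mean n X \<omega> \<in> A}) * ennreal (q k)"
    if A[measurable]: "A \<in> sets borel" for A k
  proof -
    have "(\<integral>\<^sup>+s. ennreal (H k s) * indicator A s \<partial>lborel)
      = emeasure M {\<omega> \<in> space M. sample_mean n X \<omega> \<in> A \<and> dispersion_ratio n a p X \<omega> \<in> {..t k}}"
    proof (subst joint_law)
      show "(\<integral>\<^sup>+s. ennreal (H k s) * indicator A s \<partial>lborel)
        = (\<integral>\<^sup>+s. indicator A s * (ennreal (s ^ (n - 1)) * indicator {0<..} s *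
        (\<integral>\<^sup>+z. ennreal (\<Prod>i=1..n. f (s * ray_point n z i)) * indicator {..t k} (ray_ratio z) \<partial>ray_measure n))
        \<partial>lborel)"
      proof (rule nn_integral_cong)
        fix s :: real
        show "ennreal (H k s) * indicator A s = indicator A s * (ennreal (s ^ (n - 1)) * indicator {0<..} s *
        (\<integral>\<^sup>+z. ennreal (\<Prod>i=1..n. f (s * ray_point n z i)) * indicator {..t k} (ray_ratio z) \<partial>ray_measure n))"
        proof (cases "s > 0")
          case True
          then have "ennreal (s ^ (n - 1) * avg f k s) = ennreal (s ^ (n - 1)) * ennreal (avg f k s)"
            by (intro ennreal_mult avg_nonneg zero_le_power) simp
          then show ?thesis unfolding slice[OF True] using True by (simp add: H_def mult_ac)
        qed (simp add: H_def)
      qed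
    qed auto
    also have "\<dots> = ennreal (prob {\<omega> \<in> space M. sample_mean n X \<omega> \<in> A} * q k)"
      unfolding emeasure_eq_measure q_def
      by (subst prob_indep_random_variable[OF ind]) auto
    finally show ?thesis by (simp add: ennreal_mult q_def)
  qed
  have q_nonneg: "q k \<ge> 0" for k by (simp add: q_def)
  have "q 0 \<noteq> 0"
  proof
    assume "q 0 = 0"
    then have "(\<integral>\<^sup>+s. ennreal (H 0 s) \<partial>lborel) = 0" using law_H[of UNIV 0] by simp
    then have "AE s in lborel. ennreal (H 0 s) = 0" by (subst (asm) nn_integral_0_iff_AE) auto
    then have "AE s in lborel. s > 0 \<longrightarrow> avg f 0 s = 0"
    proof eventually_elim
      case (elim s)
      then show ?case using H_nonneg[of 0 s] by (auto simp: H_def)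
    qed
    then have "avg f 0 1 = 0"
      by (intro eq_of_AE_eq_continuous[where \<psi>="\<lambda>_. 0"] avg_continuous cont f_meas) auto
    then show False using avg_pos[of 1 0] by simp
  qed
  \<comment> \<open>By independence \<open>H k / q k\<close> is the density of the mean for every \<open>k\<close>, so it can be compared with
    the one for \<open>k = 0\<close>. Densities agree almost everywhere, and continuity removes the exceptional set.\<close>
  have factor: "avg f k s = q k * (avg f 0 s / q 0)" if "s > 0" for k s
  proof -
    have "density lborel (\<lambda>s. ennreal (q 0) * ennreal (H k s)) = density lborel (\<lambda>s. ennreal (q k) * ennreal (H 0 s))"
    proof (rule measure_eqI)
      fix A assume "A \<in> sets (density lborel (\<lambda>s. ennreal (q 0) * ennreal (H k s)))"
      then have A[measurable]: "A \<in> sets borel" by simp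
      have "emeasure (density lborel (\<lambda>s. ennreal (q i) * ennreal (H j s))) A
        = ennreal (q i) * (ennreal (prob {\<omega> \<in> space M. sample_mean n X \<omega> \<in> A}) * ennreal (q j))" for i j
        unfolding law_H[OF A, symmetric] by (subst emeasure_density) (auto simp: mult.assoc nn_integral_cmult)
      then show "emeasure (density lborel (\<lambda>s. ennreal (q 0) * ennreal (H k s))) A
        = emeasure (density lborel (\<lambda>s. ennreal (q k) * ennreal (H 0 s))) A"
        by (simp add: mult_ac)
    qed simp
    then have "AE s in lborel. ennreal (q 0) * ennreal (H k s) = ennreal (q k) * ennreal (H 0 s)"
      by (intro sigma_finite_measure.density_unique[OF sigma_finite_lborel]) auto
    then have "AE s in lborel. s > 0 \<longrightarrow> q 0 * avg f k s = q k * avg f 0 s"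
    proof eventually_elim
      case (elim s)
      then have "q 0 * H k s = q k * H 0 s"
        by (simp add: ennreal_mult[symmetric] q_nonneg H_nonneg)
      then show ?case by (auto simp: H_def)
    qed
    then have "q 0 * avg f k s = q k * avg f 0 s"
      using that by (intro eq_of_AE_eq_continuous[where \<phi>="\<lambda>s. q 0 * avg f k s" and \<psi>="\<lambda>s. q k * avg f 0 s"]
          continuous_intros avg_continuous cont f_meas) auto
    then show ?thesis using \<open>q 0 \<noteq> 0\<close> by (simp add: field_simps)
  qed
  obtain A \<beta> C where C: "C > 0" "\<And>s. s > 0 \<Longrightarrow> f s = C * s powr A * exp (- \<beta> * s)"
    using power_exponential_of_factorization[OF f_meas cont pos factor] by blast
  show ?thesis
    by (rule gamma_distribution_of_power_exponential[OF f_zero C(2) C(1) total_mass])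
qed

end

theorem corollary3:
  fixes M :: "'a measure" and X :: "nat \<Rightarrow> 'a \<Rightarrow> real" and F :: "real measure"
    and f :: "real \<Rightarrow> real" and n :: nat and p :: real and a :: "nat \<Rightarrow> real"
  assumes "prob_space M"
    and "n \<ge> 3"
    and "prob_space.indep_vars M (\<lambda>_. borel) X {1..n}"
    and "\<And>i. i \<in> {1..n} \<Longrightarrow> distr M borel (X i) = F"
    and "\<And>i. i \<in> {1..n} \<Longrightarrow> AE \<omega> in M. X i \<omega> > 0"
    and "f \<in> borel_measurable borel"
    and "\<And>x. f x \<ge> 0"
    and "F = density lborel (\<lambda>x. ennreal (f x))"
    and "\<And>x. x > 0 \<Longrightarrow> f x > 0"
    and "continuous_on {0<..} f"
    and "p > 0"
    and "a 1 > 0"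
    and "a n > 0"
    and "\<And>i. i \<in> {2..n - 1} \<Longrightarrow> a i \<ge> 0"
  shows "prob_space.indep_var M
           borel (sample_mean n X)
           borel (\<lambda>\<omega>. Z_stat n a p X \<omega> powr (1 / p) / sample_mean n X \<omega>)
         \<longleftrightarrow> gamma_distribution F"
proof -
  interpret prob_space M by fact
  note [measurable] = \<open>f \<in> borel_measurable borel\<close>
  have a_nonneg: "a i \<ge> 0" if "i \<in> {1..n}" for i
  proof -
    have "i = 1 \<or> i = n \<or> i \<in> {2..n - 1}" using that by simp linarith
    then consider "i = 1" | "i = n" | "i \<in> {2..n - 1}" by blast
    then show ?thesis using assms(12-14) by cases (auto intro: less_imp_le)
  qed
  have one: "1 \<in> {1..n}" using \<open>n \<ge> 3\<close> by simp
  have X1: "X 1 \<in> borel_measurable M" using assms(3) one unfolding indep_vars_def by auto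
  \<comment> \<open>On the nonpositive half line \<open>f\<close> vanishes only almost everywhere; \<open>f0\<close> is the version of the density
    that vanishes there everywhere.\<close>
  define f0 where "f0 x = (if x > 0 then f x else 0)" for x
  have f0_meas: "f0 \<in> borel_measurable borel" unfolding f0_def[abs_def] by measurable
  have "AE x in F. x > 0"
    using assms(5)[OF one] X1 unfolding assms(4)[OF one, symmetric]
    by (subst AE_distr_iff) auto
  then have "AE x in lborel. ennreal (f x) = ennreal (f0 x)"
    unfolding assms(8) by (subst (asm) AE_density) (auto simp: f0_def assms(7) elim!: eventually_mono intro: antisym simp flip: not_less)
  then have F0: "F = density lborel (\<lambda>x. ennreal (f0 x))"
    unfolding assms(8) using f0_meas by (intro density_cong) auto
  have sample: "positive_sample M X g n p a"
    if "g \<in> borel_measurable borel" "\<And>x. g x \<ge> 0" "\<And>x. x \<le> 0 \<Longrightarrow> g x = 0"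
      "F = density lborel (\<lambda>x. ennreal (g x))" for g
    using that assms a_nonneg by unfold_locales auto
  have ratio: "(\<lambda>\<omega>. Z_stat n a p X \<omega> powr (1 / p) / sample_mean n X \<omega>) = dispersion_ratio n a p X"
    by (simp add: fun_eq_iff dispersion_ratio_def)
  show ?thesis
    unfolding ratio
  proof
    assume ind: "indep_var borel (sample_mean n X) borel (dispersion_ratio n a p X)"
    have "continuous_on {0<..} f0"
      using \<open>continuous_on {0<..} f\<close> by (rule continuous_on_eq) (simp add: f0_def)
    then show "gamma_distribution F"
      unfolding F0 using ind assms(9)
      by (intro positive_sample.gamma_if_independent[OF sample] f0_meas F0) (auto simp: f0_def assms(7))
  next
    assume "gamma_distribution F"
    then obtain \<alpha> b where ab: "\<alpha> > 0" "b > 0" "F = density lborel (\<lambda>x. ennreal (gamma_density \<alpha> b x))"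
      unfolding gamma_distribution_def by blast
    have "gamma_density \<alpha> b \<in> borel_measurable borel"
      unfolding gamma_density_def[abs_def] by measurable
    moreover have "gamma_density \<alpha> b x \<ge> 0" for x
      using ab Gamma_real_pos[of \<alpha>] by (simp add: gamma_density_def)
    ultimately have "positive_sample M X (gamma_density \<alpha> b) n p a"
      using ab by (intro sample) (auto simp: gamma_density_def)
    then show "indep_var borel (sample_mean n X) borel (dispersion_ratio n a p X)"
      by (rule positive_sample.independent_if_gamma) simp
  qed
qed

end
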